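(* Let $d\in\mathbb{N}$, $\varepsilon>0$, $y\in\mathbb{R}^d$, and let $\Phi,R,I,\hat x,\Sigma,\mu^y,\mathcal{L}_{\mu^y}$ be as in the context. Suppose that: (1) $\Phi,R\in C^3(\mathbb{R}^d,\mathbb{R})$, $I$ has a unique global minimizer $\hat x=\hat x(y)\in\mathbb{R}^d$, and $D^2I(\hat x)$ is positive definite; (2) there is a constant $K>0$ such that $\max\{\|D^3\Phi(x)\|_\Sigma,\|D^3R(x)\|_\Sigma\}\le K$ for all $x\in\mathbb{R}^d$; (3) there is $0<\delta\le 1$ such that $I(x)\ge\frac{\delta}{2}\|x-\hat x\|_\Sigma^2$ for all $x\in\mathbb{R}^d$. Then for all $r_0\ge 0$, $$d_{\mathrm{TV}}(\mu^y,\mathcal{L}_{\mu^y})\le E_1(r_0)+E_2(r_0),$$ where $$E_1(r_0):=c_d\,\varepsilon^{-d/2}\int_0^{r_0}f(r)\,r^{d-1}\,\mathrm{d}r,\qquad E_2(r_0):=\delta^{-d/2}\left(1-\Xi_d\!\left(\frac{\delta r_0^2}{\varepsilon}\right)\right),$$ $$f(r):=\left[\exp\left(\frac{(1+\varepsilon)K}{6\varepsilon}r^3\right)-1\right]\exp\left(-\frac{1}{2\varepsilon}r^2\right)\ (r\ge 0),\qquad c_d:=\frac{2^{1-d/2}}{\Gamma(d/2)}.$$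
   Context: Let $|\cdot|$ be the Euclidean norm on $\mathbb{R}^d$. Let $G:\mathbb{R}^d\to\mathbb{R}^d$ be a (possibly nonlinear) map, $y\in\mathbb{R}^d$, $\varepsilon>0$, and $R:\mathbb{R}^d\to\mathbb{R}$ such that $\exp(-R(x))$ is the Lebesgue density of a probability measure $\mu$ on $\mathbb{R}^d$ (the prior). Put $\Phi(x):=\frac12|y-G(x)|^2$ (scaled negative log-likelihood). The MAP estimate $\hat x=\hat x(y)$ is the unique minimizer of $x\mapsto\Phi(x)+\varepsilon R(x)$, and $I(x):=\Phi(x)+\varepsilon R(x)-\Phi(\hat x)-\varepsilon R(\hat x)$, so that $I\ge0$ and $I(\hat x)=0$. The posterior $\mu^y$ is the probability measure with Lebesgue density $\frac1Z\exp(-\frac1\varepsilon I(x))$, where $Z$ is the normalization constant. Put $\Sigma:=(D^2I(\hat x))^{-1}$ (inverse Hessian). The Laplace approximation is the Gaussian measure $\mathcal{L}_{\mu^y}:=\mathcal{N}(\hat x,\varepsilon\Sigma)$. For symmetric positive definite $\Sigma$, $\|x\|_\Sigma:=|\Sigma^{-1/2}x|$, and $\|D^3\Phi(x)\|_\Sigma:=\sup\{|D^3\Phi(x)(h_1,h_2,h_3)|:\|h_1\|_\Sigma,\|h_2\|_\Sigma,\|h_3\|_\Sigma\le1\}$ (similarly for $R$). $\Xi_d(t):=\gamma(\frac d2,\frac t2)/\Gamma(\frac d2)$ for $t\ge0$, where $\gamma(a,z)=\int_0^z s^{a-1}e^{-s}\,\mathrm{d}s$ is the lower incomplete gamma function.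 Total variation distance: $d_{\mathrm{TV}}(\nu,\mu):=\sup_{A\in\mathcal{B}(\mathbb{R}^d)}|\nu(A)-\mu(A)|$. *)

theory Defs
  imports "HOL-Probability.Probability"
begin

text \<open>Frechet derivatives as bounded linear maps, so that the second and third derivatives are
  curried multilinear maps. The value is meaningful only where the function is differentiable.\<close>

definition deriv1 ::
  "('a::real_normed_vector \<Rightarrow> 'b::real_normed_vector) \<Rightarrow> 'a \<Rightarrow> 'a \<Rightarrow>\<^sub>L 'b" where
  "deriv1 f x = Blinfun (frechet_derivative f (at x))"

definition deriv2 ::
  "('a::real_normed_vector \<Rightarrow> 'b::real_normed_vector) \<Rightarrow> 'a \<Rightarrow> 'a \<Rightarrow>\<^sub>L 'a \<Rightarrow>\<^sub>L 'b" where
  "deriv2 f = deriv1 (deriv1 f)"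

definition deriv3 ::
  "('a::real_normed_vector \<Rightarrow> 'b::real_normed_vector) \<Rightarrow> 'a \<Rightarrow> 'a \<Rightarrow>\<^sub>L 'a \<Rightarrow>\<^sub>L 'a \<Rightarrow>\<^sub>L 'b" where
  "deriv3 f = deriv1 (deriv2 f)"

definition C3 :: "('a::real_normed_vector \<Rightarrow> 'b::real_normed_vector) \<Rightarrow> bool" where
  "C3 f \<longleftrightarrow>
     (\<forall>x. f differentiable (at x)) \<and>
     (\<forall>x. deriv1 f differentiable (at x)) \<and>
     (\<forall>x. deriv2 f differentiable (at x)) \<and>
     continuous_on UNIV (deriv3 f)"

definition hessian :: "(real ^ 'n \<Rightarrow> real) \<Rightarrow> real ^ 'n \<Rightarrow> real ^ 'n ^ 'n" where
  "hessian f x = (\<chi> i j. blinfun_apply (blinfun_apply (deriv2 f x) (axis i 1)) (axis j 1))"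

definition pos_def :: "real ^ 'n ^ 'n \<Rightarrow> bool" where
  "pos_def A \<longleftrightarrow> transpose A = A \<and> (\<forall>x. x \<noteq> 0 \<longrightarrow> 0 < x \<bullet> (A *v x))"

text \<open>A positive definite matrix has exactly one positive definite square root, so the choice
  made here is immaterial.\<close>

definition matrix_sqrt :: "real ^ 'n ^ 'n \<Rightarrow> real ^ 'n ^ 'n" where
  "matrix_sqrt A = (SOME B. pos_def B \<and> B ** B = A)"

definition weighted_norm :: "real ^ 'n ^ 'n \<Rightarrow> real ^ 'n \<Rightarrow> real" where
  "weighted_norm \<Sigma> x = norm (matrix_inv (matrix_sqrt \<Sigma>) *v x)"

definition deriv3_norm ::
  "real ^ 'n ^ 'n \<Rightarrow> (real ^ 'n \<Rightarrow> real) \<Rightarrow> real ^ 'n \<Rightarrow> real" where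
  "deriv3_norm \<Sigma> f x =
     Sup {\<bar>blinfun_apply (blinfun_apply (blinfun_apply (deriv3 f x) h1) h2) h3\<bar> | h1 h2 h3.
            weighted_norm \<Sigma> h1 \<le> 1 \<and> weighted_norm \<Sigma> h2 \<le> 1 \<and> weighted_norm \<Sigma> h3 \<le> 1}"

definition misfit :: "(real ^ 'n \<Rightarrow> real ^ 'n) \<Rightarrow> real ^ 'n \<Rightarrow> real ^ 'n \<Rightarrow> real" where
  "misfit G y x = 1 / 2 * (norm (y - G x))\<^sup>2"

definition prior :: "(real ^ 'n \<Rightarrow> real) \<Rightarrow> (real ^ 'n) measure" where
  "prior R = density lborel (\<lambda>x. ennreal (exp (- R x)))"

definition unique_minimizer :: "('a \<Rightarrow> real) \<Rightarrow> 'a \<Rightarrow> bool" where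
  "unique_minimizer f a \<longleftrightarrow> (\<forall>x. is_arg_min f (\<lambda>_. True) x \<longleftrightarrow> x = a)"

definition map_estimate ::
  "(real ^ 'n \<Rightarrow> real) \<Rightarrow> (real ^ 'n \<Rightarrow> real) \<Rightarrow> real \<Rightarrow> real ^ 'n" where
  "map_estimate \<Phi> R \<epsilon> = (THE a. unique_minimizer (\<lambda>x. \<Phi> x + \<epsilon> * R x) a)"

definition posterior :: "real \<Rightarrow> (real ^ 'n \<Rightarrow> real) \<Rightarrow> (real ^ 'n) measure" where
  "posterior \<epsilon> I =
     (let Z = (LINT x|lborel. exp (- (1 / \<epsilon>) * I x))
      in density lborel (\<lambda>x. ennreal (1 / Z * exp (- (1 / \<epsilon>) * I x))))"

text \<open>Normal distribution with mean m and nondegenerate covariance matrix C.\<close>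

definition gaussian :: "real ^ 'n \<Rightarrow> real ^ 'n ^ 'n \<Rightarrow> (real ^ 'n) measure" where
  "gaussian m C =
     density lborel (\<lambda>x. ennreal (exp (- (1 / 2) * ((x - m) \<bullet> (matrix_inv C *v (x - m))))
                                    / sqrt ((2 * pi) ^ CARD('n) * det C)))"

definition tv_dist :: "'a::topological_space measure \<Rightarrow> 'a measure \<Rightarrow> real" where
  "tv_dist \<nu> \<mu> = (SUP A \<in> sets borel. \<bar>measure \<nu> A - measure \<mu> A\<bar>)"

definition lower_incomplete_gamma :: "real \<Rightarrow> real \<Rightarrow> real" where
  "lower_incomplete_gamma a z = integral {0..z} (\<lambda>s. s powr (a - 1) * exp (- s))"

definition Xi :: "nat \<Rightarrow> real \<Rightarrow> real" where
  "Xi d t = lower_incomplete_gamma (real d / 2) (t / 2) / Gamma (real d / 2)"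

definition error_f :: "real \<Rightarrow> real \<Rightarrow> real \<Rightarrow> real" where
  "error_f \<epsilon> K r =
     (exp ((1 + \<epsilon>) * K / (6 * \<epsilon>) * r ^ 3) - 1) * exp (- (1 / (2 * \<epsilon>)) * r\<^sup>2)"

definition const_c :: "nat \<Rightarrow> real" where
  "const_c d = 2 powr (1 - real d / 2) / Gamma (real d / 2)"

definition E1 :: "nat \<Rightarrow> real \<Rightarrow> real \<Rightarrow> real \<Rightarrow> real" where
  "E1 d \<epsilon> K r0 =
     const_c d * \<epsilon> powr (- real d / 2) * integral {0..r0} (\<lambda>r. error_f \<epsilon> K r * r ^ (d - 1))"

definition E2 :: "nat \<Rightarrow> real \<Rightarrow> real \<Rightarrow> real \<Rightarrow> real" where
  "E2 d \<epsilon> \<delta> r0 = \<delta> powr (- real d / 2) * (1 - Xi d (\<delta> * r0\<^sup>2 / \<epsilon>))"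

end

theory Submission
  imports Defs
begin

text \<open>
  Writing \<open>p\<close> and \<open>q\<close> for the unnormalized densities \<open>exp (- I / \<epsilon>)\<close> and
  \<open>exp (- \<parallel>x - xhat\<parallel>\<^sup>2 / 2\<epsilon>)\<close> (weighted norm), the total variation distance is at most
  \<open>\<integral> \<bar>p - q\<bar> / \<integral> q\<close>. After the substitution \<open>x = xhat + \<Sigma>\<^sup>1\<^sup>/\<^sup>2 u\<close>, Taylor's theorem at the minimizer
  bounds \<open>\<bar>p - q\<bar>\<close> by \<open>error_f \<epsilon> K \<bar>u\<bar>\<close>, which is used on the ball \<open>\<bar>u\<bar> \<le> r0\<close>; outside it both
  densities are at most \<open>exp (- \<delta> \<bar>u\<bar>\<^sup>2 / 2\<epsilon>)\<close>. Polar coordinates turn the two resulting integrals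
  into \<open>E1\<close> and \<open>E2\<close>.
\<close>

subsection \<open>Symmetric and positive definite matrices\<close>

text \<open>The bound divides by the mass of \<open>q\<close> alone because that mass is explicit:
  \<open>(2 * pi * \<epsilon>) powr (d / 2) * det T\<close>, with \<open>T\<close> the square root
  of \<open>\<Sigma>\<close>. Its factor \<open>det T\<close> cancels the Jacobian of the
  substitution, and the rest turns the area of the unit sphere into
  \<open>const_c d * \<epsilon> powr (- d / 2)\<close>. The exponent in \<open>error_f\<close>
  collects three factors: the third derivative of \<open>I\<close> is that of \<open>\<Phi>\<close>
  plus \<open>\<epsilon>\<close> times that of \<open>R\<close>, hence at most
  \<open>(1 + \<epsilon>) * K\<close> in the weighted norm; Taylor's theorem contributes 1/6 and the
  exponent \<open>- I / \<epsilon>\<close> contributes \<open>1 / \<epsilon>\<close>. In the tail,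
  \<open>\<delta> \<le> 1\<close> puts \<open>q\<close> under the same Gaussian as \<open>p\<close>,
  and \<open>\<delta> powr (- d / 2)\<close> is the ratio of the mass of that Gaussian to the mass
  of \<open>q\<close>. The weighted norm rests on a chosen square root, so nothing can be said about
  it before such a root is known to exist; hence the spectral theorem. The same diagonalization
  serves again to split the linear substitution into rotations and a scaling of the axes.\<close>

lemma symmetric_inner_swap:
  fixes A :: "real^'n^'n"
  assumes "transpose A = A"
  shows "(A *v x) \<bullet> y = x \<bullet> (A *v y)"
  by (metis assms dot_lmul_matrix vector_transpose_matrix)

text \<open>Rayleigh's principle: the orthogonal complement \<open>W\<close> of a set of
  eigenvectors is invariant under a symmetric matrix, and a maximizer of the quadratic form on the
  unit sphere of \<open>W\<close> is an eigenvector. The bound on \<open>dim S\<close> makes this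
  sphere nonempty.\<close>

lemma symmetric_eigenvector_orthogonal_to:
  fixes A :: "real^'n^'n"
  assumes sym: "transpose A = A"
    and eig: "\<And>s. s \<in> S \<Longrightarrow> \<exists>c. A *v s = c *\<^sub>R s"
    and dim: "dim S < CARD('n)"
  obtains v c where "norm v = 1" "A *v v = c *\<^sub>R v" "\<And>s. s \<in> S \<Longrightarrow> s \<bullet> v = 0"
proof -
  define W where "W = {x. \<forall>s\<in>S. s \<bullet> x = 0}"
  have W: "subspace W"
    unfolding W_def subspace_def by (auto simp: inner_right_distrib)
  have AW: "A *v x \<in> W" if "x \<in> W" for x
  proof -
    have "s \<bullet> (A *v x) = 0" if "s \<in> S" for s
    proof -
      obtain c where "A *v s = c *\<^sub>R s" using eig \<open>s \<in> S\<close> by blast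
      then have "s \<bullet> (A *v x) = c * (s \<bullet> x)"
        by (simp flip: symmetric_inner_swap[OF sym])
      then show ?thesis using \<open>x \<in> W\<close> \<open>s \<in> S\<close> by (simp add: W_def)
    qed
    then show ?thesis by (simp add: W_def)
  qed
  obtain w where "w \<noteq> 0" and w: "\<And>y. y \<in> span S \<Longrightarrow> orthogonal w y"
    using orthogonal_to_subspace_exists[of S] dim by auto
  then have "w \<in> W"
    by (auto simp: W_def orthogonal_def inner_commute span_base)
  define q where "q x = x \<bullet> (A *v x)" for x
  have "compact (W \<inter> sphere 0 1)"
    by (simp add: W closed_subspace closed_Int_compact)
  moreover have "(1 / norm w) *\<^sub>R w \<in> W \<inter> sphere 0 1"
    using \<open>w \<noteq> 0\<close> \<open>w \<in> W\<close> W by (auto intro: subspace_scale)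
  moreover have "continuous_on (W \<inter> sphere 0 1) q"
    unfolding q_def by (intro continuous_intros)
  ultimately obtain v where v: "v \<in> W" "norm v = 1"
    and max: "\<And>x. x \<in> W \<Longrightarrow> norm x = 1 \<Longrightarrow> q x \<le> q v"
    using continuous_attains_sup[of "W \<inter> sphere 0 1" q] by force
  define c where "c = q v"
  have quad: "q x \<le> c * (x \<bullet> x)" if "x \<in> W" for x
  proof (cases "x = 0")
    case False
    have "q ((1 / norm x) *\<^sub>R x) \<le> c"
      unfolding c_def using False that W by (intro max) (auto intro: subspace_scale)
    moreover have "q ((1 / norm x) *\<^sub>R x) = q x / (x \<bullet> x)"
      by (simp add: q_def matrix_vector_mult_scaleR dot_square_norm power2_eq_square)
    ultimately show ?thesis using False by (simp add: field_simps)
  qed (simp add: q_def)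
  \<comment> \<open>The residual \<open>z\<close> stays in \<open>W\<close>, so \<open>v\<close> may
    be varied in the direction \<open>z\<close> itself. Inserting \<open>v + t *\<^sub>R z\<close>
    into \<open>quad\<close> cancels the terms of order zero in \<open>t\<close>; what survives is a
    linear term \<open>2 * t * (z \<bullet> z)\<close> against a quadratic one.\<close>
  define z where "z = A *v v - c *\<^sub>R v"
  have "z \<in> W"
    unfolding z_def using v(1) AW W by (intro subspace_diff subspace_scale) auto
  define M where "M = c * (z \<bullet> z) - q z"
  have bound: "2 * t * (z \<bullet> z) \<le> t\<^sup>2 * M" for t
  proof -
    have 1: "q (v + t *\<^sub>R z) \<le> c * ((v + t *\<^sub>R z) \<bullet> (v + t *\<^sub>R z))"
      using v(1) \<open>z \<in> W\<close> W by (intro quad subspace_add subspace_scale)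
    have 2: "q (v + t *\<^sub>R z) = c + 2 * t * (z \<bullet> (A *v v)) + t\<^sup>2 * q z"
      using symmetric_inner_swap[OF sym, of z v]
      by (simp add: q_def c_def matrix_vector_right_distrib matrix_vector_mult_scaleR
          inner_right_distrib inner_left_distrib inner_commute power2_eq_square algebra_simps)
    have 3: "(v + t *\<^sub>R z) \<bullet> (v + t *\<^sub>R z) = 1 + 2 * t * (z \<bullet> v) + t\<^sup>2 * (z \<bullet> z)"
      using v(2) by (simp add: norm_eq_1 inner_right_distrib inner_left_distrib inner_commute
          power2_eq_square algebra_simps)
    have 4: "z \<bullet> (A *v v) = z \<bullet> z + c * (z \<bullet> v)"
      by (subst (2) z_def) (simp add: inner_diff_right)
    show ?thesis
      using 1[unfolded 2 3 4] by (simp add: M_def algebra_simps)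
  qed
  have "z \<bullet> z = 0"
  proof (rule ccontr)
    assume "z \<bullet> z \<noteq> 0"
    then have pos: "z \<bullet> z > 0" by simp
    \<comment> \<open>This \<open>t\<close> solves
      \<open>t\<^sup>2 * (\<bar>M\<bar> + 1) = t * (z \<bullet> z)\<close>, which is half of the
      linear term; the summand 1 keeps the denominator positive.\<close>
    define t where "t = (z \<bullet> z) / (\<bar>M\<bar> + 1)"
    have "t > 0" using pos by (simp add: t_def add_nonneg_pos)
    have "2 * t * (z \<bullet> z) \<le> t\<^sup>2 * (\<bar>M\<bar> + 1)"
      by (rule order_trans[OF bound mult_left_mono]) auto
    also have "\<dots> = t * (z \<bullet> z)"
      by (simp add: t_def power2_eq_square add_nonneg_eq_0_iff)
    finally show False using pos \<open>t > 0\<close> by simp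
  qed
  then have "A *v v = c *\<^sub>R v" by (simp add: z_def)
  with v that show ?thesis by (auto simp: W_def)
qed

text \<open>As long as fewer than \<open>CARD('n)\<close> orthonormal eigenvectors are present,
  their span is proper and one more can be added orthogonally.\<close>

lemma symmetric_orthonormal_eigenvectors:
  fixes A :: "real^'n^'n"
  assumes sym: "transpose A = A" and "k \<le> CARD('n)"
  shows "\<exists>S. finite S \<and> card S = k \<and> (\<forall>s\<in>S. norm s = 1 \<and> (\<exists>c. A *v s = c *\<^sub>R s))
    \<and> pairwise orthogonal S"
  using assms(2)
proof (induction k)
  case (Suc k)
  then obtain S where S: "finite S" "card S = k" "pairwise orthogonal S"
    and eig: "\<And>s. s \<in> S \<Longrightarrow> norm s = 1 \<and> (\<exists>c. A *v s = c *\<^sub>R s)"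
    by auto
  have "dim S < CARD('n)"
    using dim_le_card'[OF S(1)] S(2) Suc.prems by simp
  then obtain v c where v: "norm v = 1" "A *v v = c *\<^sub>R v" "\<And>s. s \<in> S \<Longrightarrow> s \<bullet> v = 0"
    using symmetric_eigenvector_orthogonal_to[OF sym, of S] eig by metis
  then have "v \<notin> S" by force
  moreover have "pairwise orthogonal (insert v S)"
    using S(3) v(3) by (auto simp: pairwise_insert orthogonal_def inner_commute)
  ultimately show ?case
    using S eig v by (intro exI[of _ "insert v S"]) auto
qed auto

section \<open>Orthogonal diagonalization of symmetric matrices\<close>

definition diag_mat :: "('n \<Rightarrow> real) \<Rightarrow> real^'n^'n" where
  "diag_mat c = (\<chi> i j. if i = j then c i else 0)"

lemma diag_mat_mult: "diag_mat c ** diag_mat e = diag_mat (\<lambda>i. c i * e i)"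
  by (simp add: diag_mat_def matrix_matrix_mult_def vec_eq_iff
      if_distrib[where f = "\<lambda>u. u * x" for x] cong: if_cong)

lemma transpose_diag_mat [simp]: "transpose (diag_mat c) = diag_mat c"
  by (auto simp: diag_mat_def transpose_def vec_eq_iff)

lemma diag_mat_vector: "(diag_mat c *v x) $ i = c i * x $ i"
  by (simp add: diag_mat_def matrix_vector_mult_def
      if_distrib[where f = "\<lambda>u. u * x" for x] cong: if_cong)

lemma det_diag_mat: "det (diag_mat c) = (\<Prod>i\<in>UNIV. c i)"
  by (subst det_diagonal) (auto simp: diag_mat_def)

theorem symmetric_diagonalization:
  fixes A :: "real^'n^'n"
  assumes sym: "transpose A = A"
  obtains Q c where "orthogonal_matrix Q" "A = Q ** diag_mat c ** transpose Q"
proof -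
  obtain S where S: "finite S" "card S = CARD('n)" "pairwise orthogonal S"
    and eig: "\<forall>s\<in>S. norm s = 1 \<and> (\<exists>c. A *v s = c *\<^sub>R s)"
    using symmetric_orthonormal_eigenvectors[OF sym order_refl] by metis
  obtain f where f: "bij_betw f (UNIV :: 'n set) S"
    using finite_same_card_bij[OF finite S(1)] S(2) by auto
  have fS: "f i \<in> S" for i using f by (auto simp: bij_betw_def)
  have "\<forall>i. \<exists>c. A *v f i = c *\<^sub>R f i"
    using eig fS by blast
  then obtain c where c: "\<And>i. A *v f i = c i *\<^sub>R f i"
    unfolding choice_iff by blast
  \<comment> \<open>The eigenvectors are the columns of \<open>Q\<close>, so orthonormality says
    that \<open>Q\<close> is orthogonal, and \<open>A ** Q = Q ** diag_mat c\<close> is the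
    eigenvalue equation read column by column.\<close>
  define Q :: "real^'n^'n" where "Q = (\<chi> i j. f j $ i)"
  have ff: "f i \<bullet> f j = (if i = j then 1 else 0)" for i j
  proof (cases "i = j")
    case True
    then show ?thesis using eig fS by (simp add: norm_eq_1)
  next
    case False
    then have "f i \<noteq> f j" using f by (auto simp: bij_betw_def inj_on_def)
    then show ?thesis using False S(3) fS by (auto simp: pairwise_def orthogonal_def)
  qed
  have Q: "orthogonal_matrix Q"
    unfolding orthogonal_matrix
    by (simp add: vec_eq_iff matrix_matrix_mult_def transpose_def Q_def mat_def
        ff[unfolded inner_vec_def inner_real_def])
  have "A ** Q = Q ** diag_mat c"
  proof -
    have "(A ** Q) $ i $ j = (Q ** diag_mat c) $ i $ j" for i j
    proof -
      have "(A ** Q) $ i $ j = (A *v f j) $ i"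
        by (simp add: matrix_matrix_mult_def matrix_vector_mult_def Q_def)
      then show ?thesis
        by (simp add: c matrix_matrix_mult_def Q_def diag_mat_def if_distrib cong: if_cong)
    qed
    then show ?thesis by (simp add: vec_eq_iff)
  qed
  then have "A = Q ** diag_mat c ** transpose Q"
    by (metis Q matrix_mul_assoc matrix_mul_rid orthogonal_matrix_def)
  with Q that show ?thesis by blast
qed

section \<open>Square roots, determinants and inverses of positive definite matrices\<close>

lemma pos_def_diagonalization:
  fixes A :: "real^'n^'n"
  assumes A: "pos_def A"
  obtains Q c where "orthogonal_matrix Q" "\<And>i. c i > 0" "A = Q ** diag_mat c ** transpose Q"
proof -
  obtain Q c where Q: "orthogonal_matrix Q" and eq: "A = Q ** diag_mat c ** transpose Q"
    using A symmetric_diagonalization unfolding pos_def_def by blast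
  \<comment> \<open>The eigenvalue \<open>c i\<close> is the value of the quadratic form of
    \<open>A\<close> at the i-th column \<open>Q *v ?e\<close> of \<open>Q\<close>.\<close>
  have "c i > 0" for i
  proof -
    let ?e = "axis i 1 :: real^'n"
    have QQ: "transpose Q *v (Q *v ?e) = ?e"
      using Q by (simp add: matrix_vector_mul_assoc orthogonal_matrix_def)
    then have "Q *v ?e \<noteq> 0"
      by (metis axis_eq_0_iff matrix_vector_mult_0_right zero_neq_one)
    then have "0 < (Q *v ?e) \<bullet> (A *v (Q *v ?e))" using A by (simp add: pos_def_def)
    also have "A *v (Q *v ?e) = Q *v (diag_mat c *v ?e)"
      using QQ by (simp add: eq flip: matrix_vector_mul_assoc)
    also have "(Q *v ?e) \<bullet> (Q *v (diag_mat c *v ?e)) = ?e \<bullet> (diag_mat c *v ?e)"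
      using Q orthogonal_transformation_matrix[of "(*v) Q"]
      by (simp add: orthogonal_transformation_def)
    also have "\<dots> = c i" by (simp add: inner_axis' diag_mat_vector)
    finally show ?thesis .
  qed
  with Q eq that show ?thesis by blast
qed

lemma pos_def_sandwich:
  fixes Q :: "real^'n^'n"
  assumes Q: "orthogonal_matrix Q" and c: "\<And>i. c i > 0"
  shows "pos_def (Q ** diag_mat c ** transpose Q)"
  unfolding pos_def_def
proof (intro conjI allI impI)
  show "transpose (Q ** diag_mat c ** transpose Q) = Q ** diag_mat c ** transpose Q"
    by (simp add: matrix_transpose_mul matrix_mul_assoc)
  fix x :: "real^'n" assume "x \<noteq> 0"
  define z where "z = transpose Q *v x"
  have "Q *v z = x"
    using Q by (simp only: z_def matrix_vector_mul_assoc orthogonal_matrix_def matrix_vector_mul_lid)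
  with \<open>x \<noteq> 0\<close> have "z \<noteq> 0" by auto
  then obtain i where "z $ i \<noteq> 0" by (auto simp: vec_eq_iff)
  then have "0 < (\<Sum>i\<in>UNIV. c i * (z $ i)\<^sup>2)"
    using c by (intro sum_pos2[of _ i]) (auto simp: less_imp_le)
  also have "\<dots> = z \<bullet> (diag_mat c *v z)"
    by (simp add: inner_vec_def diag_mat_vector power2_eq_square mult_ac)
  also have "\<dots> = x \<bullet> ((Q ** diag_mat c ** transpose Q) *v x)"
    by (metis dot_lmul_matrix matrix_vector_mul_assoc vector_transpose_matrix z_def transpose_transpose)
  finally show "0 < x \<bullet> ((Q ** diag_mat c ** transpose Q) *v x)" .
qed

text \<open>Since \<open>matrix_sqrt\<close> is a \<open>SOME\<close>, both properties follow from
  one witness: the same eigenbasis with the eigenvalues replaced by their square roots.\<close>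

lemma matrix_sqrt:
  fixes A :: "real^'n^'n"
  assumes "pos_def A"
  shows pos_def_matrix_sqrt: "pos_def (matrix_sqrt A)"
    and matrix_sqrt_mult_self: "matrix_sqrt A ** matrix_sqrt A = A"
proof -
  obtain Q c where Q: "orthogonal_matrix Q" and c: "\<And>i. c i > 0"
    and eq: "A = Q ** diag_mat c ** transpose Q"
    using pos_def_diagonalization[OF assms] by blast
  let ?B = "Q ** diag_mat (\<lambda>i. sqrt (c i)) ** transpose Q"
  have "?B ** ?B = Q ** diag_mat (\<lambda>i. sqrt (c i)) ** (transpose Q ** Q) ** diag_mat (\<lambda>i. sqrt (c i)) ** transpose Q"
    by (simp add: matrix_mul_assoc)
  also have "\<dots> = Q ** (diag_mat (\<lambda>i. sqrt (c i)) ** diag_mat (\<lambda>i. sqrt (c i))) ** transpose Q"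
    using Q by (simp add: orthogonal_matrix_def matrix_mul_assoc)
  also have "\<dots> = A"
    using c by (simp add: diag_mat_mult eq less_imp_le)
  finally have "pos_def ?B \<and> ?B ** ?B = A"
    using pos_def_sandwich[OF Q, of "\<lambda>i. sqrt (c i)"] c by simp
  then have "pos_def (matrix_sqrt A) \<and> matrix_sqrt A ** matrix_sqrt A = A"
    unfolding matrix_sqrt_def by (rule someI)
  then show "pos_def (matrix_sqrt A)" "matrix_sqrt A ** matrix_sqrt A = A" by auto
qed

lemma det_pos_def:
  fixes A :: "real^'n^'n"
  assumes "pos_def A"
  shows "det A > 0"
proof -
  obtain Q c where Q: "orthogonal_matrix Q" and c: "\<And>i. c i > 0"
    and eq: "A = Q ** diag_mat c ** transpose Q"
    using pos_def_diagonalization[OF assms] by blast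
  have "det Q * det Q = 1"
    using det_orthogonal_matrix[OF Q] by auto
  then have "det A = (\<Prod>i\<in>UNIV. c i)"
    by (simp add: eq det_mul det_diag_mat)
  then show ?thesis using c by (simp add: prod_pos)
qed

text \<open>\<open>matrix_inv\<close> chooses among two-sided inverses; for square matrices a right
  inverse is already two-sided, and it is unique.\<close>

lemma matrix_inv_eq:
  fixes A :: "real^'n^'n"
  assumes "A ** B = mat 1"
  shows "matrix_inv A = B"
proof -
  have BA: "B ** A = mat 1" using assms by (simp add: matrix_left_right_inverse)
  then have "A ** matrix_inv A = mat 1 \<and> matrix_inv A ** A = mat 1"
    unfolding matrix_inv_def using assms
    by (intro someI[where P = "\<lambda>A'. A ** A' = mat 1 \<and> A' ** A = mat 1" and x = B] conjI)
  then have inv: "A ** matrix_inv A = mat 1" ..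
  have "matrix_inv A = (B ** A) ** matrix_inv A" by (simp add: BA)
  also have "\<dots> = B" by (simp add: inv flip: matrix_mul_assoc)
  finally show ?thesis .
qed

lemma pos_def_matrix_inv_mult:
  fixes A :: "real^'n^'n"
  assumes "pos_def A"
  shows "A ** matrix_inv A = mat 1" "matrix_inv A ** A = mat 1"
proof -
  obtain B where "A ** B = mat 1"
    using det_pos_def[OF assms] by (metis invertible_det_nz invertible_def less_irrefl)
  then show "A ** matrix_inv A = mat 1" using matrix_inv_eq by metis
  then show "matrix_inv A ** A = mat 1" by (simp add: matrix_left_right_inverse)
qed

lemma pos_def_matrix_inv:
  fixes A :: "real^'n^'n"
  assumes A: "pos_def A"
  shows "pos_def (matrix_inv A)"
  unfolding pos_def_def
proof (intro conjI allI impI)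
  let ?B = "matrix_inv A"
  have "transpose A = A" using A by (simp add: pos_def_def)
  then have "A ** transpose ?B = transpose (?B ** A)"
    by (simp only: matrix_transpose_mul)
  also have "\<dots> = mat 1"
    by (simp only: pos_def_matrix_inv_mult[OF A] transpose_mat)
  finally show "transpose ?B = ?B" by (rule matrix_inv_eq[symmetric])
  fix x :: "real^'n" assume "x \<noteq> 0"
  have x: "A *v (?B *v x) = x"
    by (simp add: matrix_vector_mul_assoc pos_def_matrix_inv_mult[OF A])
  then have "?B *v x \<noteq> 0" using \<open>x \<noteq> 0\<close> by force
  then have "0 < (?B *v x) \<bullet> (A *v (?B *v x))" using A by (simp add: pos_def_def)
  then show "0 < x \<bullet> (?B *v x)" by (simp add: x inner_commute)
qed

subsection \<open>Orthogonal and linear substitutions in Lebesgue integrals\<close>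

text \<open>
  The library's change of variables for linear maps requires a well-ordered index type. For an
  arbitrary finite index type, invariance under orthogonal maps comes from the uniqueness of Haar
  measure, whose Fubini proof follows.
\<close>

lemma lborel_translation_invariant_eq:
  fixes \<nu> :: "'a::euclidean_space measure"
  assumes "sigma_finite_measure \<nu>" and sets: "sets \<nu> = sets borel"
    and inv: "\<And>a. distr \<nu> borel (\<lambda>x. a + x) = \<nu>"
    and A[measurable]: "A \<in> sets borel" and B[measurable]: "B \<in> sets borel"
  shows "emeasure \<nu> A * emeasure lborel B = emeasure \<nu> (uminus -` B) * emeasure lborel A"
proof -
  interpret \<nu>: sigma_finite_measure \<nu> by fact
  interpret pair_sigma_finite \<nu> lborel ..
  have [measurable_cong]: "sets \<nu> = sets borel" by fact
  have "emeasure \<nu> A * emeasure lborel B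
      = (\<integral>\<^sup>+y. (\<integral>\<^sup>+x. indicator A x * indicator B y \<partial>\<nu>) \<partial>lborel)"
    by (simp add: nn_integral_cmult nn_integral_multc)
  \<comment> \<open>Translation invariance is used three times. Shifting \<open>x\<close> by
    \<open>y\<close> and exchanging the integrals lets \<open>y\<close> be shifted back by
    \<open>x\<close>, after which \<open>x\<close> occurs only in \<open>B (y - x)\<close>; a last
    shift of \<open>x\<close> by \<open>y\<close> makes the inner integral independent of
    \<open>y\<close>.\<close>
  also have "\<dots> = (\<integral>\<^sup>+y. (\<integral>\<^sup>+x. indicator A (y + x) * indicator B y \<partial>\<nu>) \<partial>lborel)"
  proof (rule nn_integral_cong)
    fix y
    show "(\<integral>\<^sup>+x. indicator A x * indicator B y \<partial>\<nu>)
        = (\<integral>\<^sup>+x. indicator A (y + x) * indicator B y \<partial>\<nu>)"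
      by (subst inv[of y, symmetric]) (simp add: nn_integral_distr)
  qed
  also have "\<dots> = (\<integral>\<^sup>+x. (\<integral>\<^sup>+y. indicator A (y + x) * indicator B y \<partial>lborel) \<partial>\<nu>)"
    by (rule Fubini') simp
  also have "\<dots> = (\<integral>\<^sup>+x. (\<integral>\<^sup>+y. indicator A y * indicator B (y - x) \<partial>lborel) \<partial>\<nu>)"
  proof (rule nn_integral_cong)
    fix x
    have "(\<integral>\<^sup>+y. indicator A y * indicator B (y - x) \<partial>lborel)
        = (\<integral>\<^sup>+y. indicator A y * indicator B (y - x) \<partial>distr lborel borel (\<lambda>y. x + y))"
      using lborel_affine[of 1 x] by (simp add: density_1)
    also have "\<dots> = (\<integral>\<^sup>+y. indicator A (y + x) * indicator B y \<partial>lborel)"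
      by (simp add: nn_integral_distr add.commute)
    finally show "(\<integral>\<^sup>+y. indicator A (y + x) * indicator B y \<partial>lborel)
        = (\<integral>\<^sup>+y. indicator A y * indicator B (y - x) \<partial>lborel)" ..
  qed
  also have "\<dots> = (\<integral>\<^sup>+y. (\<integral>\<^sup>+x. indicator A y * indicator B (y - x) \<partial>\<nu>) \<partial>lborel)"
    by (rule Fubini'[symmetric]) simp
  also have "\<dots> = (\<integral>\<^sup>+y. indicator A y * emeasure \<nu> (uminus -` B) \<partial>lborel)"
  proof (rule nn_integral_cong)
    fix y
    have "(\<integral>\<^sup>+x. indicator B (y - x) \<partial>\<nu>) = (\<integral>\<^sup>+x. indicator B (- x) \<partial>\<nu>)"
      by (subst inv[of y, symmetric]) (simp add: nn_integral_distr)
    also have "\<dots> = (\<integral>\<^sup>+x. indicator (uminus -` B) x \<partial>\<nu>)"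
      by (simp add: indicator_def)
    also have "\<dots> = emeasure \<nu> (uminus -` B)"
    proof (rule nn_integral_indicator)
      have "uminus -` B \<inter> space (borel::'a measure) \<in> sets borel" by measurable
      then show "uminus -` B \<in> sets \<nu>" by (simp add: sets)
    qed
    finally show "(\<integral>\<^sup>+x. indicator A y * indicator B (y - x) \<partial>\<nu>)
        = indicator A y * emeasure \<nu> (uminus -` B)"
      by (simp add: nn_integral_cmult)
  qed
  also have "\<dots> = emeasure \<nu> (uminus -` B) * emeasure lborel A"
    by (simp add: nn_integral_multc mult.commute)
  finally show ?thesis .
qed

text \<open>The image measure is translation invariant because \<open>a + f x = f (g a + x)\<close>
  for the inverse \<open>g\<close>, and it agrees with \<open>lborel\<close> on centred balls
  because \<open>f\<close> preserves norms. Testing against the unit ball, which is its own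
  reflection and has finite positive volume, forces the proportionality factor to be 1.\<close>

lemma lborel_distr_orthogonal:
  fixes f :: "'a::euclidean_space \<Rightarrow> 'a"
  assumes f: "orthogonal_transformation f"
  shows "distr lborel borel f = lborel"
proof -
  have lin: "linear f" using f by (rule orthogonal_transformation_linear)
  have [measurable]: "f \<in> borel_measurable borel"
    by (intro borel_measurable_continuous_onI linear_continuous_on linear_linear[THEN iffD2] lin)
  obtain g where g: "orthogonal_transformation g" and fg: "\<And>x. f (g x) = x" "\<And>x. g (f x) = x"
    using orthogonal_transformation_inv[OF f] orthogonal_transformation_bij[OF f]
    by (metis bij_inv_eq_iff)
  let ?\<nu> = "distr lborel borel f"
  have ball: "f -` cball 0 r = cball 0 r" for r
    using orthogonal_transformation_norm[OF f] by auto
  have eball: "emeasure ?\<nu> (cball 0 r) = emeasure lborel (cball (0::'a) r)" for r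
    by (simp add: emeasure_distr ball)
  have inv: "distr ?\<nu> borel (\<lambda>x. a + x) = ?\<nu>" for a
  proof -
    have "distr ?\<nu> borel (\<lambda>x. a + x) = distr lborel borel (\<lambda>x. a + f x)"
      by (simp add: distr_distr comp_def)
    also have "(\<lambda>x. a + f x) = (\<lambda>x. f (g a + x))"
      by (simp add: fg linear_add[OF lin])
    also have "distr lborel borel (\<lambda>x. f (g a + x)) = distr (distr lborel borel (\<lambda>x. g a + x)) borel f"
      by (simp add: distr_distr comp_def)
    also have "distr lborel borel (\<lambda>x. g a + x) = lborel"
      using lborel_affine[of 1 "g a"] by (simp add: density_1)
    finally show ?thesis .
  qed
  have sf: "sigma_finite_measure ?\<nu>"
  proof
    show "\<exists>A. countable A \<and> A \<subseteq> sets ?\<nu> \<and> \<Union>A = space ?\<nu> \<and> (\<forall>a\<in>A. emeasure ?\<nu> a \<noteq> \<infinity>)"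
    proof (intro exI[of _ "range (\<lambda>n::nat. cball 0 (real n))"] conjI ballI)
      show "(\<Union>n. cball 0 (real n)) = space ?\<nu>"
        by (auto intro: real_arch_simple)
    qed (auto simp: eball emeasure_cball simp del: emeasure_distr)
  qed
  have um: "uminus -` cball (0::'a) 1 = cball 0 1" by auto
  show ?thesis
  proof (rule measure_eqI)
    fix A assume "A \<in> sets ?\<nu>"
    then have "emeasure ?\<nu> A * emeasure lborel (cball (0::'a) 1)
        = emeasure ?\<nu> (uminus -` cball 0 1) * emeasure lborel A"
      using sf inv by (intro lborel_translation_invariant_eq) auto
    then have "emeasure lborel (cball (0::'a) 1) * emeasure ?\<nu> A
        = emeasure lborel (cball (0::'a) 1) * emeasure lborel A"
      by (simp only: um eball mult.commute)
    moreover have "emeasure lborel (cball (0::'a) 1) \<noteq> 0" "emeasure lborel (cball (0::'a) 1) \<noteq> \<infinity>"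
      by (simp_all add: emeasure_cball ennreal_eq_0_iff not_le)
    ultimately show "emeasure ?\<nu> A = emeasure lborel A"
      by (simp add: ennreal_mult_cancel_left)
  qed simp
qed

section \<open>Substitution under orthogonal, diagonal and positive definite matrices\<close>

lemma nn_integral_lborel_orthogonal_matrix:
  fixes F :: "real^'n \<Rightarrow> ennreal"
  assumes "orthogonal_matrix Q" and [measurable]: "F \<in> borel_measurable borel"
  shows "(\<integral>\<^sup>+x. F (Q *v x) \<partial>lborel) = (\<integral>\<^sup>+x. F x \<partial>lborel)"
proof -
  have "orthogonal_transformation ((*v) Q)"
    using assms(1) by (simp add: orthogonal_transformation_matrix)
  then have "(\<integral>\<^sup>+x. F x \<partial>lborel) = (\<integral>\<^sup>+x. F x \<partial>distr lborel borel ((*v) Q))"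
    by (simp only: lborel_distr_orthogonal)
  also have "\<dots> = (\<integral>\<^sup>+x. F (Q *v x) \<partial>lborel)"
    by (rule nn_integral_distr) (auto intro!: borel_measurable_continuous_onI continuous_intros)
  finally show ?thesis ..
qed

lemma nn_integral_lborel_diag_mat:
  fixes F :: "real^'n \<Rightarrow> ennreal"
  assumes c: "\<And>i. c i > 0" and [measurable]: "F \<in> borel_measurable borel"
  shows "(\<integral>\<^sup>+x. F x \<partial>lborel) = ennreal (\<Prod>i\<in>UNIV. c i) * (\<integral>\<^sup>+x. F (diag_mat c *v x) \<partial>lborel)"
proof -
  \<comment> \<open>\<open>e\<close> carries the diagonal entries over from the index type
    \<open>'n\<close> to \<open>Basis\<close>, the index set in which the affine transformation of
    \<open>lborel\<close> is formulated.\<close>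
  define e where "e j = j \<bullet> (diag_mat c *v j)" for j :: "real^'n"
  have e: "e (axis i 1) = c i" for i
    by (simp add: e_def inner_axis' diag_mat_vector)
  have B: "(Basis :: (real^'n) set) = range (\<lambda>i. axis i 1)"
    by (auto simp: Basis_vec_def)
  have D: "(\<Sum>j\<in>Basis. (e j * (x \<bullet> j)) *\<^sub>R j) = diag_mat c *v x" for x
  proof (rule euclidean_eqI)
    fix b :: "real^'n" assume b: "b \<in> Basis"
    then obtain i where "b = axis i 1" using B by auto
    moreover have "(\<Sum>j\<in>Basis. (e j * (x \<bullet> j)) *\<^sub>R j) \<bullet> b = e b * (x \<bullet> b)"
      using b by (rule inner_sum_left_Basis)
    ultimately show "(\<Sum>j\<in>Basis. (e j * (x \<bullet> j)) *\<^sub>R j) \<bullet> b = (diag_mat c *v x) \<bullet> b"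
      by (simp add: e inner_axis diag_mat_vector)
  qed
  have "inj (\<lambda>i::'n. axis i (1::real))" by (auto simp: inj_on_def axis_eq_axis)
  then have P: "(\<Prod>j\<in>Basis. \<bar>e j\<bar>) = (\<Prod>i\<in>UNIV. c i)"
    using c by (simp add: B prod.reindex e less_imp_le abs_of_pos)
  have "e j \<noteq> 0" if "j \<in> Basis" for j
    using that e c unfolding B by (metis imageE less_irrefl)
  then have "lborel = density (distr lborel borel (\<lambda>x. 0 + (\<Sum>j\<in>Basis. (e j * (x \<bullet> j)) *\<^sub>R j))) (\<lambda>_. \<Prod>j\<in>Basis. \<bar>e j\<bar>)"
    by (rule lborel_affine_euclidean)
  then have "lborel = density (distr lborel borel ((*v) (diag_mat c))) (\<lambda>_. ennreal (\<Prod>i\<in>UNIV. c i))"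
    by (simp add: D P)
  then have "(\<integral>\<^sup>+x. F x \<partial>lborel) = (\<integral>\<^sup>+x. F x \<partial>density (distr lborel borel ((*v) (diag_mat c))) (\<lambda>_. ennreal (\<Prod>i\<in>UNIV. c i)))"
    by simp
  also have "\<dots> = ennreal (\<Prod>i\<in>UNIV. c i) * (\<integral>\<^sup>+x. F x \<partial>distr lborel borel ((*v) (diag_mat c)))"
    by (subst nn_integral_density) (simp_all add: nn_integral_cmult)
  also have "(\<integral>\<^sup>+x. F x \<partial>distr lborel borel ((*v) (diag_mat c))) = (\<integral>\<^sup>+x. F (diag_mat c *v x) \<partial>lborel)"
    by (rule nn_integral_distr) (auto intro!: borel_measurable_continuous_onI continuous_intros)
  finally show ?thesis .
qed

text \<open>With \<open>T = Q ** diag_mat c ** transpose Q\<close>, the translation and the two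
  orthogonal factors preserve the integral; only the diagonal factor contributes, and its
  determinant is \<open>det T\<close> since \<open>det Q\<close> squares to 1.\<close>

lemma nn_integral_lborel_affine_pos_def:
  fixes F :: "real^'n \<Rightarrow> ennreal"
  assumes T: "pos_def T" and [measurable]: "F \<in> borel_measurable borel"
  shows "(\<integral>\<^sup>+x. F x \<partial>lborel) = ennreal (det T) * (\<integral>\<^sup>+u. F (m + T *v u) \<partial>lborel)"
proof -
  obtain Q c where Q: "orthogonal_matrix Q" and c: "\<And>i. c i > 0"
    and eq: "T = Q ** diag_mat c ** transpose Q"
    using pos_def_diagonalization[OF T] by blast
  have [measurable]: "(*v) A \<in> borel_measurable borel" for A :: "real^'n^'n"
    by (intro borel_measurable_continuous_onI continuous_intros)
  have "det Q * det Q = 1"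
    using det_orthogonal_matrix[OF Q] by auto
  then have det: "det T = (\<Prod>i\<in>UNIV. c i)"
    by (simp add: eq det_mul det_diag_mat)
  have "(\<integral>\<^sup>+x. F x \<partial>lborel) = (\<integral>\<^sup>+x. F x \<partial>distr lborel borel (\<lambda>x. m + x))"
    using lborel_affine[of 1 m] by (simp add: density_1)
  also have "\<dots> = (\<integral>\<^sup>+x. F (m + x) \<partial>lborel)"
    by (simp add: nn_integral_distr)
  also have "\<dots> = (\<integral>\<^sup>+x. F (m + Q *v x) \<partial>lborel)"
    by (rule nn_integral_lborel_orthogonal_matrix[OF Q, symmetric]) simp
  also have "\<dots> = ennreal (det T) * (\<integral>\<^sup>+x. F (m + Q *v (diag_mat c *v x)) \<partial>lborel)"
    unfolding det by (rule nn_integral_lborel_diag_mat[OF c]) simp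
  also have "(\<integral>\<^sup>+x. F (m + Q *v (diag_mat c *v x)) \<partial>lborel)
      = (\<integral>\<^sup>+x. F (m + Q *v (diag_mat c *v (transpose Q *v x))) \<partial>lborel)"
    using Q by (intro nn_integral_lborel_orthogonal_matrix[symmetric])
      (auto simp: orthogonal_matrix_def transpose_transpose)
  finally show ?thesis by (simp only: eq matrix_vector_mul_assoc matrix_mul_assoc)
qed

subsection \<open>Radial integrals\<close>

text \<open>The half-lines \<open>{..a}\<close> generate the Borel sets and are stable under
  intersection. On them the left side is the volume of a ball,
  \<open>unit_ball_vol d * a ^ d\<close>, whose derivative in the radius is the density on the
  right.\<close>

lemma distr_norm_lborel:
  "distr (lborel :: 'a::euclidean_space measure) borel norm
   = density lborel (\<lambda>r. ennreal (DIM('a) * unit_ball_vol DIM('a) * r ^ (DIM('a) - 1)) * indicator {0..} r)"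
  (is "?L = ?R")
proof (rule measure_eqI_generator_eq[where \<Omega> = UNIV and E = "range atMost"
      and A = "\<lambda>n::nat. {..real n}"])
  let ?d = "DIM('a)" and ?v = "unit_ball_vol DIM('a)"
  have L: "emeasure ?L {..a} = ennreal (?v * a ^ ?d)" if "a \<ge> 0" for a
  proof -
    have "norm -` {..a} = cball (0::'a) a" by auto
    then show ?thesis using that by (simp add: emeasure_distr emeasure_cball)
  qed
  have R: "emeasure ?R {..a} = ennreal (?v * a ^ ?d)" if "a \<ge> 0" for a
  proof -
    have "emeasure ?R {..a} = (\<integral>\<^sup>+r. ennreal (?d * ?v * r ^ (?d - 1)) * indicator {0..a} r \<partial>lborel)"
      by (subst emeasure_density) (auto intro!: nn_integral_cong split: split_indicator)
    also have "\<dots> = ennreal (?v * a ^ ?d - ?v * 0 ^ ?d)"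
    proof (rule nn_integral_FTC_Icc)
      fix r :: real assume "r \<in> {0..a}"
      show "((\<lambda>r. ?v * r ^ ?d) has_real_derivative ?d * ?v * r ^ (?d - 1)) (at r)"
        by (auto intro!: derivative_eq_intros)
      show "0 \<le> ?d * ?v * r ^ (?d - 1)"
        using \<open>r \<in> {0..a}\<close> by simp
    qed (use that in auto)
    finally show ?thesis by (simp add: power_0_left)
  qed
  fix X :: "real set" assume "X \<in> range atMost"
  then obtain a where X: "X = {..a}" by auto
  show "emeasure ?L X = emeasure ?R X"
  proof (cases "a \<ge> 0")
    case False
    then have "norm -` {..a} = ({}::'a set)" using norm_ge_zero order_trans by blast
    moreover have "(\<integral>\<^sup>+r. ennreal (?d * ?v * r ^ (?d - 1)) * indicator {0..} r * indicator {..a} r \<partial>lborel)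
        = (\<integral>\<^sup>+(r::real). 0 \<partial>lborel)"
      using False by (intro nn_integral_cong) (auto split: split_indicator)
    ultimately show ?thesis
      by (simp add: X emeasure_distr emeasure_density)
  next
    case True
    then show ?thesis unfolding X by (simp only: L R)
  qed
next
  show "sets ?L = sigma_sets UNIV (range atMost)" "sets ?R = sigma_sets UNIV (range atMost)"
    by (simp_all add: borel_eq_atMost[where 'a = real])
  show "emeasure ?L {..real n} \<noteq> \<infinity>" for n
  proof -
    have "norm -` {..real n} = cball (0::'a) n" by auto
    then show ?thesis by (simp add: emeasure_distr emeasure_cball)
  qed
  show "(\<Union>n. {..real n}) = UNIV" by (auto intro: real_arch_simple)
qed (auto simp: Int_stable_def)

lemma nn_integral_norm_lborel:
  fixes g :: "real \<Rightarrow> ennreal"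
  assumes [measurable]: "g \<in> borel_measurable borel"
  shows "(\<integral>\<^sup>+(x::'a::euclidean_space). g (norm x) \<partial>lborel)
    = DIM('a) * unit_ball_vol DIM('a) * (\<integral>\<^sup>+r. ennreal (r ^ (DIM('a) - 1)) * indicator {0..} r * g r \<partial>lborel)"
proof -
  have "(\<integral>\<^sup>+(x::'a). g (norm x) \<partial>lborel) = (\<integral>\<^sup>+r. g r \<partial>distr (lborel :: 'a measure) borel norm)"
    by (simp add: nn_integral_distr)
  also have "\<dots> = (\<integral>\<^sup>+r. ennreal (DIM('a) * unit_ball_vol DIM('a)) *
      (ennreal (r ^ (DIM('a) - 1)) * indicator {0..} r * g r) \<partial>lborel)"
    unfolding distr_norm_lborel
    by (subst nn_integral_density)
      (auto intro!: nn_integral_cong simp: ennreal_mult' mult_ac split: split_indicator)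
  also have "\<dots> = DIM('a) * unit_ball_vol DIM('a) * (\<integral>\<^sup>+r. ennreal (r ^ (DIM('a) - 1)) * indicator {0..} r * g r \<partial>lborel)"
    by (simp add: nn_integral_cmult)
  finally show ?thesis .
qed

text \<open>This is the area of the unit sphere, brought to the form with
  \<open>Gamma (n / 2)\<close> in which \<open>const_c\<close> and \<open>Xi\<close> are
  normalized.\<close>

lemma sphere_area:
  assumes "n > 0"
  shows "real n * unit_ball_vol n = 2 * pi powr (n / 2) / Gamma (n / 2)"
proof -
  have eq: "Gamma (real n / 2 + 1) = real n / 2 * Gamma (real n / 2)"
    using assms by (intro Gamma_plus1) (auto elim!: nonpos_Ints_cases')
  show ?thesis using assms unfolding unit_ball_vol_def eq by simp
qed

text \<open>The substitution \<open>s = a * r\<^sup>2\<close>, under which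
  \<open>s powr (d / 2 - 1) ds\<close> becomes \<open>2 * a powr (d / 2) * r ^ (d - 1) dr\<close>.
  It links the incomplete gamma function to radial Gaussian integrals.\<close>

lemma nn_integral_gaussian_substitution:
  fixes a :: real and d :: nat
  assumes a: "a > 0" and d: "d > 0" and b: "b > 0"
  shows "(\<integral>\<^sup>+s. ennreal (s powr (d / 2 - 1) * exp (- s)) * indicator {0..a * b\<^sup>2} s \<partial>lborel)
    = 2 * a powr (d / 2) * (\<integral>\<^sup>+r. ennreal (r ^ (d - 1) * exp (- a * r\<^sup>2)) * indicator {0..b} r \<partial>lborel)"
proof -
  have "(\<integral>\<^sup>+s. ennreal (s powr (d / 2 - 1) * exp (- s)) * indicator {a * 0\<^sup>2..a * b\<^sup>2} s \<partial>lborel)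
    = (\<integral>\<^sup>+r. ennreal ((a * r\<^sup>2) powr (d / 2 - 1) * exp (- (a * r\<^sup>2))) * ennreal (2 * a * r) * indicator {0..b} r \<partial>lborel)"
  proof (rule nn_integral_substitution_aux)
    show "((\<lambda>r. a * r\<^sup>2) has_real_derivative 2 * a * r) (at r)" for r
      by (auto intro!: derivative_eq_intros)
    show "continuous_on {0..b} (\<lambda>r. 2 * a * r)" by (intro continuous_intros)
  qed (use a b in auto)
  also have "\<dots> = (\<integral>\<^sup>+r. ennreal (2 * a powr (d / 2)) * (ennreal (r ^ (d - 1) * exp (- a * r\<^sup>2)) * indicator {0..b} r) \<partial>lborel)"
  proof (rule nn_integral_cong_AE)
    have *: "(a * r\<^sup>2) powr (d / 2 - 1) * exp (- (a * r\<^sup>2)) * (2 * a * r)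
        = 2 * a powr (d / 2) * (r ^ (d - 1) * exp (- a * r\<^sup>2))" if "r > 0" for r
    proof -
      have "(a * r\<^sup>2) powr (d / 2 - 1) * (a * r) = a powr (d / 2) * r ^ (d - 1)"
      proof -
        have "(r\<^sup>2) powr (d / 2 - 1) = r powr (2 * (d / 2 - 1))"
          using powr_powr[of r 2 "d / 2 - 1"] that by simp
        also have "2 * (d / 2 - 1) = real d - 2" by simp
        finally have "(a * r\<^sup>2) powr (d / 2 - 1) = a powr (d / 2 - 1) * r powr (real d - 2)"
          using a that by (simp add: powr_mult)
        moreover have "a powr (d / 2 - 1) * a = a powr (d / 2)"
          using a by (simp add: powr_diff)
        moreover have "r powr (real d - 2) * r = r powr (real (d - 1))"
        proof -
          have "r powr (real d - 2) * r powr 1 = r powr (real (d - 1))"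
            using d unfolding powr_add[symmetric] by (simp add: of_nat_diff)
          then show ?thesis using that by simp
        qed
        ultimately have "(a * r\<^sup>2) powr (d / 2 - 1) * (a * r) = a powr (d / 2) * r powr (real (d - 1))"
          by (metis mult.assoc mult.left_commute)
        then show ?thesis
          using that by (simp add: powr_realpow)
      qed
      then show ?thesis by (simp add: algebra_simps)
    qed
    \<comment> \<open>At \<open>r = 0\<close> the integrands differ when \<open>d = 1\<close>: the
      left one vanishes through its factor \<open>2 * a * r\<close>, while
      \<open>r ^ (d - 1)\<close> is 1. Equality almost everywhere suffices.\<close>
    have "AE r in lborel. r \<noteq> (0::real)" by (rule AE_lborel_singleton)
    then show "AE r in lborel. ennreal ((a * r\<^sup>2) powr (d / 2 - 1) * exp (- (a * r\<^sup>2))) * ennreal (2 * a * r) * indicator {0..b} r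
        = ennreal (2 * a powr (d / 2)) * (ennreal (r ^ (d - 1) * exp (- a * r\<^sup>2)) * indicator {0..b} r)"
    proof eventually_elim
      case (elim r)
      show ?case
      proof (cases "r \<in> {0..b}")
        case True
        then have "r > 0" using elim by auto
        then have "ennreal ((a * r\<^sup>2) powr (d / 2 - 1) * exp (- (a * r\<^sup>2))) * ennreal (2 * a * r)
            = ennreal (2 * a powr (d / 2)) * ennreal (r ^ (d - 1) * exp (- a * r\<^sup>2))"
          using a by (subst (1 2) ennreal_mult''[symmetric]) (auto simp only: *, auto)
        then show ?thesis using True by simp
      qed simp
    qed
  qed
  also have "\<dots> = 2 * a powr (d / 2) * (\<integral>\<^sup>+r. ennreal (r ^ (d - 1) * exp (- a * r\<^sup>2)) * indicator {0..b} r \<partial>lborel)"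
    by (simp add: nn_integral_cmult)
  finally show ?thesis by simp
qed

section \<open>Gaussian mass of balls, of the whole space and of tails\<close>

lemma lower_incomplete_gamma_integrable:
  fixes a z :: real
  assumes "a > 0"
  shows "(\<lambda>s. s powr (a - 1) * exp (- s)) integrable_on {0..z}"
proof -
  have "(\<lambda>s. s powr (a - 1) * exp (- s)) integrable_on {0..}"
    using Gamma_integral_real[OF assms] by (auto simp: exp_minus divide_inverse integrable_on_def)
  then show ?thesis
    by (rule integrable_on_subinterval) auto
qed

lemma lower_incomplete_gamma_nonneg: "a > 0 \<Longrightarrow> lower_incomplete_gamma a z \<ge> 0"
  unfolding lower_incomplete_gamma_def
  by (intro integral_nonneg lower_incomplete_gamma_integrable) auto

lemma nn_integral_lower_incomplete_gamma:
  assumes "a > 0"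
  shows "(\<integral>\<^sup>+s. ennreal (s powr (a - 1) * exp (- s)) * indicator {0..z} s \<partial>lborel)
    = ennreal (lower_incomplete_gamma a z)"
  using lower_incomplete_gamma_integrable[OF assms]
  by (intro nn_integral_has_integral_lebesgue')
    (auto simp: lower_incomplete_gamma_def integrable_integral)

text \<open>In probabilistic terms, \<open>2 * a * (norm x)\<^sup>2\<close> is chi-squared with
  \<open>DIM('a)\<close> degrees of freedom under the normalized Gaussian, and \<open>Xi\<close> is
  the distribution function of that law. The constant is the sphere area divided by the factor
  \<open>2 * a powr (d / 2)\<close> of the radial substitution.\<close>

lemma nn_integral_gaussian_cball:
  fixes a r0 :: real
  assumes a: "a > 0" and r0: "r0 \<ge> 0"
  shows "(\<integral>\<^sup>+(x::'a::euclidean_space). ennreal (exp (- a * (norm x)\<^sup>2)) * indicator {..r0} (norm x) \<partial>lborel)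
    = ennreal ((pi / a) powr (DIM('a) / 2) * Xi DIM('a) (2 * a * r0\<^sup>2))"
proof (cases "r0 = 0")
  \<comment> \<open>The radial substitution is stated for a positive radius; a ball of radius 0 is a
    null set.\<close>
  case True
  have "Xi d 0 = 0" for d by (simp add: Xi_def lower_incomplete_gamma_def)
  moreover have "(\<integral>\<^sup>+(x::'a). ennreal (exp (- a * (norm x)\<^sup>2)) * indicator {..0} (norm x) \<partial>lborel)
      = (\<integral>\<^sup>+(x::'a). 0 \<partial>lborel)"
    by (rule nn_integral_cong_AE)
      (use AE_lborel_singleton[of "0::'a"] in eventually_elim, auto split: split_indicator)
  ultimately show ?thesis using True by simp
next
  case False
  let ?d = "DIM('a)"
  let ?J = "\<integral>\<^sup>+r. ennreal (r ^ (?d - 1) * exp (- a * r\<^sup>2)) * indicator {0..r0} r \<partial>lborel"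
  have ap: "a powr (?d / 2) > 0" using a by simp
  have "ennreal (2 * a powr (?d / 2)) * ?J = ennreal (lower_incomplete_gamma (?d / 2) (a * r0\<^sup>2))"
    using nn_integral_gaussian_substitution[of a ?d r0] nn_integral_lower_incomplete_gamma[of "?d / 2" "a * r0\<^sup>2"]
      a r0 False by simp
  then have "ennreal (1 / (2 * a powr (?d / 2))) * (ennreal (2 * a powr (?d / 2)) * ?J)
      = ennreal (1 / (2 * a powr (?d / 2))) * ennreal (lower_incomplete_gamma (?d / 2) (a * r0\<^sup>2))"
    by simp
  then have J: "?J = ennreal (lower_incomplete_gamma (?d / 2) (a * r0\<^sup>2) / (2 * a powr (?d / 2)))"
    using ap by (simp add: mult.assoc[symmetric] flip: ennreal_mult ennreal_mult')
  have "(\<integral>\<^sup>+(x::'a). ennreal (exp (- a * (norm x)\<^sup>2)) * indicator {..r0} (norm x) \<partial>lborel)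
      = ?d * unit_ball_vol ?d * (\<integral>\<^sup>+r. ennreal (r ^ (?d - 1)) * indicator {0..} r * (ennreal (exp (- a * r\<^sup>2)) * indicator {..r0} r) \<partial>lborel)"
    by (rule nn_integral_norm_lborel) simp
  also have "(\<integral>\<^sup>+r. ennreal (r ^ (?d - 1)) * indicator {0..} r * (ennreal (exp (- a * r\<^sup>2)) * indicator {..r0} r) \<partial>lborel) = ?J"
    by (intro nn_integral_cong) (auto simp: ennreal_mult split: split_indicator)
  also have "ennreal (?d * unit_ball_vol ?d) * ?J
      = ennreal (?d * unit_ball_vol ?d * (lower_incomplete_gamma (?d / 2) (a * r0\<^sup>2) / (2 * a powr (?d / 2))))"
    unfolding J by (subst (2) ennreal_mult') auto
  also have "?d * unit_ball_vol ?d * (lower_incomplete_gamma (?d / 2) (a * r0\<^sup>2) / (2 * a powr (?d / 2)))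
      = (pi / a) powr (?d / 2) * Xi ?d (2 * a * r0\<^sup>2)"
    using a by (simp add: sphere_area Xi_def powr_divide)
  finally show ?thesis .
qed


text \<open>Continuity from below of the measure with density \<open>f\<close>.\<close>

lemma nn_integral_exhaustion:
  assumes [measurable]: "f \<in> borel_measurable M" "\<And>n. A n \<in> sets M"
    and A: "incseq A" "(\<Union>n. A n) = space M"
  shows "(\<integral>\<^sup>+x. f x \<partial>M) = (SUP n. \<integral>\<^sup>+x. f x * indicator (A n) x \<partial>M)"
proof -
  have "(SUP n. emeasure (density M f) (A n)) = emeasure (density M f) (\<Union>n. A n)"
    using A(1) by (intro SUP_emeasure_incseq) auto
  then show ?thesis
    by (simp add: emeasure_density A(2) cong: nn_integral_cong)
qed

text \<open>The end points \<open>b * (real n)\<^sup>2\<close> are those that balls of radius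
  \<open>n\<close> produce, so the limit fits the exhaustion of the whole space by balls.\<close>

lemma SUP_lower_incomplete_gamma:
  assumes "a > 0" "b > 0"
  shows "(SUP n::nat. ennreal (lower_incomplete_gamma a (b * (real n)\<^sup>2))) = ennreal (Gamma a)"
proof -
  let ?f = "\<lambda>s. ennreal (s powr (a - 1) * exp (- s)) * indicator {0..} s"
  define A where "A n = {..b * (real n)\<^sup>2}" for n :: nat
  have "ennreal (Gamma a) = (\<integral>\<^sup>+s. ?f s \<partial>lborel)"
    using nn_integral_has_integral_lebesgue'[OF _ Gamma_integral_real[OF assms(1)]]
    by (simp add: exp_minus divide_inverse)
  also have "\<dots> = (SUP n. \<integral>\<^sup>+s. ?f s * indicator (A n) s \<partial>lborel)"
  proof (rule nn_integral_exhaustion)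
    show "incseq A"
      using assms(2) by (auto simp: incseq_def A_def intro!: mult_left_mono power_mono order_trans)
    have "\<exists>n::nat. s \<le> b * (real n)\<^sup>2" for s
    proof -
      obtain n :: nat where "n > s / b" "n \<ge> 1"
        using reals_Archimedean2[of "max 1 (s / b)"] by force
      then have "s \<le> b * n" using assms(2) by (simp add: field_simps)
      also have "\<dots> \<le> b * (real n)\<^sup>2"
        using assms(2) \<open>n \<ge> 1\<close> by (simp add: power2_eq_square)
      finally show ?thesis by blast
    qed
    then show "(\<Union>n. A n) = space lborel" by (auto simp: A_def)
  qed (auto simp: A_def)
  also have "(\<lambda>n. \<integral>\<^sup>+s. ?f s * indicator (A n) s \<partial>lborel) = (\<lambda>n. ennreal (lower_incomplete_gamma a (b * (real n)\<^sup>2)))"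
    using assms unfolding A_def
    by (subst nn_integral_lower_incomplete_gamma[symmetric])
      (auto intro!: nn_integral_cong split: split_indicator)
  finally show ?thesis ..
qed

text \<open>Let the radius tend to infinity in the formula for balls: the incomplete gamma function
  increases to \<open>Gamma (d / 2)\<close>, which cancels the denominator of
  \<open>Xi\<close>.\<close>

lemma nn_integral_gaussian:
  fixes a :: real
  assumes a: "a > 0"
  shows "(\<integral>\<^sup>+(x::'a::euclidean_space). ennreal (exp (- a * (norm x)\<^sup>2)) \<partial>lborel)
    = ennreal ((pi / a) powr (DIM('a) / 2))"
proof -
  let ?d = "DIM('a)"
  have G: "Gamma (?d / 2) > 0" by (intro Gamma_real_pos) simp
  let ?C = "(pi / a) powr (?d / 2) / Gamma (?d / 2)"
  have "(\<integral>\<^sup>+(x::'a). ennreal (exp (- a * (norm x)\<^sup>2)) \<partial>lborel)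
      = (SUP n. \<integral>\<^sup>+(x::'a). ennreal (exp (- a * (norm x)\<^sup>2)) * indicator (cball 0 (real n)) x \<partial>lborel)"
  proof (rule nn_integral_exhaustion)
    show "incseq (\<lambda>n. cball (0::'a) (real n))" by (auto simp: incseq_def)
    show "(\<Union>n. cball (0::'a) (real n)) = space lborel" by (auto intro: real_arch_simple)
  qed auto
  also have "\<dots> = (SUP n. \<integral>\<^sup>+(x::'a). ennreal (exp (- a * (norm x)\<^sup>2)) * indicator {..real n} (norm x) \<partial>lborel)"
    by (simp add: indicator_def)
  also have "\<dots> = (SUP n. ennreal ?C * ennreal (lower_incomplete_gamma (?d / 2) (a * (real n)\<^sup>2)))"
    using a G by (subst nn_integral_gaussian_cball) (auto simp: Xi_def simp flip: ennreal_mult')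
  also have "\<dots> = ennreal ?C * (SUP n::nat. ennreal (lower_incomplete_gamma (?d / 2) (a * (real n)\<^sup>2)))"
    by (simp add: SUP_mult_left_ennreal)
  also have "\<dots> = ennreal ?C * ennreal (Gamma (?d / 2))"
    using a by (subst SUP_lower_incomplete_gamma) auto
  also have "\<dots> = ennreal (?C * Gamma (?d / 2))"
    using G by (subst ennreal_mult') auto
  also have "?C * Gamma (?d / 2) = (pi / a) powr (?d / 2)"
    using order.strict_implies_not_eq[OF G] by simp
  finally show ?thesis .
qed

lemma nn_integral_gaussian_tail:
  fixes a r0 :: real
  assumes a: "a > 0" and r0: "r0 \<ge> 0"
  shows "(\<integral>\<^sup>+(x::'a::euclidean_space). ennreal (exp (- a * (norm x)\<^sup>2)) * indicator {r0<..} (norm x) \<partial>lborel)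
    = ennreal ((pi / a) powr (DIM('a) / 2) * (1 - Xi DIM('a) (2 * a * r0\<^sup>2)))"
proof -
  let ?f = "\<lambda>x::'a. ennreal (exp (- a * (norm x)\<^sup>2))"
  let ?C = "(pi / a) powr (DIM('a) / 2)" and ?X = "Xi DIM('a) (2 * a * r0\<^sup>2)"
  let ?T = "\<integral>\<^sup>+x. ?f x * indicator {r0<..} (norm x) \<partial>lborel"
  have C: "?C > 0" using a by simp
  have X: "?X \<ge> 0"
    unfolding Xi_def
    by (intro divide_nonneg_nonneg lower_incomplete_gamma_nonneg Gamma_real_nonneg) auto
  have "ennreal ?C = (\<integral>\<^sup>+x. ?f x * indicator {..r0} (norm x) + ?f x * indicator {r0<..} (norm x) \<partial>lborel)"
    unfolding nn_integral_gaussian[OF a, symmetric]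
    by (intro nn_integral_cong) (auto split: split_indicator)
  also have "\<dots> = ennreal (?C * ?X) + ?T"
    by (subst nn_integral_add) (auto simp only: nn_integral_gaussian_cball[OF a r0], auto)
  finally have sum: "ennreal ?C = ennreal (?C * ?X) + ?T" .
  \<comment> \<open>The mass of the ball is finite, so it may be subtracted in
    \<open>ennreal\<close>.\<close>
  have "?T = (ennreal (?C * ?X) + ?T) - ennreal (?C * ?X)"
    by (rule ennreal_add_diff_cancel_left[symmetric]) simp
  also have "\<dots> = ennreal ?C - ennreal (?C * ?X)"
    by (simp only: sum)
  also have "\<dots> = ennreal (?C * (1 - ?X))"
    using C X by (subst ennreal_minus) (auto simp: algebra_simps)
  finally show ?thesis .
qed

text \<open>Keeps the tail term nonnegative; \<open>ennreal\<close> would otherwise truncate it to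
  0.\<close>

lemma Xi_le_1:
  assumes "d > 0" "t \<ge> 0"
  shows "Xi d t \<le> 1"
proof -
  have d: "real d / 2 > 0" using assms by simp
  then have G: "Gamma (real d / 2) > 0" by (rule Gamma_real_pos)
  let ?f = "\<lambda>s::real. s powr (real d / 2 - 1) * exp (- s)"
  have 1: "(?f has_integral Gamma (real d / 2)) {0..}"
    using Gamma_integral_real[OF d] by (simp only: exp_minus divide_inverse)
  have 2: "(?f has_integral lower_incomplete_gamma (real d / 2) (t / 2)) {0..t / 2}"
    using lower_incomplete_gamma_integrable[OF d]
    unfolding lower_incomplete_gamma_def by (rule integrable_integral)
  have "{0..t / 2} \<subseteq> {0..}" by auto
  then have "lower_incomplete_gamma (real d / 2) (t / 2) \<le> Gamma (real d / 2)"
    by (rule has_integral_subset_le[OF _ 2 1]) simp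
  then show ?thesis using G by (simp add: Xi_def)
qed

subsection \<open>Third-order Taylor expansion\<close>

lemma has_derivative_deriv1:
  assumes "f differentiable (at x)"
  shows "(f has_derivative blinfun_apply (deriv1 f x)) (at x)"
proof -
  have "(f has_derivative frechet_derivative f (at x)) (at x)"
    using assms by (simp add: frechet_derivative_works)
  moreover from this have "bounded_linear (frechet_derivative f (at x))"
    by (rule has_derivative_bounded_linear)
  ultimately show ?thesis
    by (simp add: deriv1_def bounded_linear_Blinfun_apply)
qed

lemma deriv1_eqI:
  assumes "(f has_derivative blinfun_apply D) (at x)"
  shows "deriv1 f x = D"
proof -
  have "frechet_derivative f (at x) = blinfun_apply D"
    using frechet_derivative_at[OF assms] by simp
  then show ?thesis by (simp add: deriv1_def blinfun_apply_inverse)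
qed

text \<open>The codomain is arbitrary so that the same statement applies in turn to functions and to
  their first and second derivatives. The constant \<open>k\<close> accommodates the shift that
  makes \<open>I\<close> vanish at the minimizer.\<close>

lemma deriv1_linear_combination:
  assumes "\<And>x. f differentiable (at x)" "\<And>x. g differentiable (at x)"
  shows "(\<lambda>x. f x + c *\<^sub>R g x + k) differentiable (at x)"
    and "deriv1 (\<lambda>x. f x + c *\<^sub>R g x + k) = (\<lambda>x. deriv1 f x + c *\<^sub>R deriv1 g x)"
proof -
  have *: "((\<lambda>x. f x + c *\<^sub>R g x + k) has_derivative blinfun_apply (deriv1 f x + c *\<^sub>R deriv1 g x)) (at x)" for x
    using has_derivative_deriv1[OF assms(1)[of x]] has_derivative_deriv1[OF assms(2)[of x]]
    by (auto intro!: derivative_eq_intros simp: blinfun.add_left blinfun.scaleR_left)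
  then show "(\<lambda>x. f x + c *\<^sub>R g x + k) differentiable (at x)"
    by (auto simp: differentiable_def)
  show "deriv1 (\<lambda>x. f x + c *\<^sub>R g x + k) = (\<lambda>x. deriv1 f x + c *\<^sub>R deriv1 g x)"
    using * by (intro ext deriv1_eqI)
qed

lemma C3_linear_combination:
  fixes f g :: "'a::real_normed_vector \<Rightarrow> 'b::real_normed_vector"
  assumes f: "C3 f" and g: "C3 g"
  shows "C3 (\<lambda>x. f x + c *\<^sub>R g x + k)"
    and "deriv3 (\<lambda>x. f x + c *\<^sub>R g x + k) = (\<lambda>x. deriv3 f x + c *\<^sub>R deriv3 g x)"
proof -
  let ?h = "\<lambda>x. f x + c *\<^sub>R g x + k"
  have d: "f differentiable (at x)" "g differentiable (at x)"
    "deriv1 f differentiable (at x)" "deriv1 g differentiable (at x)"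
    "deriv2 f differentiable (at x)" "deriv2 g differentiable (at x)" for x
    using f g by (auto simp: C3_def)
  have 1: "deriv1 ?h = (\<lambda>x. deriv1 f x + c *\<^sub>R deriv1 g x)"
    by (rule deriv1_linear_combination) (rule d)+
  have 2: "deriv2 ?h = (\<lambda>x. deriv2 f x + c *\<^sub>R deriv2 g x)"
    using deriv1_linear_combination(2)[OF d(3,4), of c 0] by (simp add: deriv2_def 1)
  show 3: "deriv3 ?h = (\<lambda>x. deriv3 f x + c *\<^sub>R deriv3 g x)"
    using deriv1_linear_combination(2)[OF d(5,6), of c 0] by (simp add: deriv3_def 2)
  show "C3 ?h"
    unfolding C3_def 1 2 3
  proof (intro conjI allI)
    show "?h differentiable (at x)" for x
      by (rule deriv1_linear_combination) (rule d)+
    show "(\<lambda>x. deriv1 f x + c *\<^sub>R deriv1 g x) differentiable (at x)" for x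
      using deriv1_linear_combination(1)[OF d(3,4), of c 0] by simp
    show "(\<lambda>x. deriv2 f x + c *\<^sub>R deriv2 g x) differentiable (at x)" for x
      using deriv1_linear_combination(1)[OF d(5,6), of c 0] by simp
    show "continuous_on UNIV (\<lambda>x. deriv3 f x + c *\<^sub>R deriv3 g x)"
      using f g by (auto simp: C3_def intro!: continuous_intros)
  qed
qed

lemma has_vector_derivative_along_line:
  assumes "\<And>x. F differentiable (at x)"
  shows "((\<lambda>t. F (x + t *\<^sub>R h)) has_vector_derivative deriv1 F (x + t *\<^sub>R h) h) (at t)"
proof -
  have "((\<lambda>t. x + t *\<^sub>R h) has_derivative (\<lambda>s. s *\<^sub>R h)) (at t)"
    by (auto intro!: derivative_eq_intros)
  from has_derivative_compose[OF this has_derivative_deriv1[OF assms]]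
  show ?thesis
    by (simp add: has_vector_derivative_def blinfun.scaleR_right)
qed

text \<open>The one-dimensional Maclaurin formula for \<open>f (x + t *\<^sub>R h)\<close> on the
  interval from 0 to 1. The intermediate \<open>t\<close> may stay unlocated, as the bound on the
  third derivative will hold at every point.\<close>

lemma C3_taylor:
  fixes f :: "'a::real_normed_vector \<Rightarrow> real"
  assumes "C3 f"
  obtains t where "f (x + h) = f x + deriv1 f x h + deriv2 f x h h / 2
    + deriv3 f (x + t *\<^sub>R h) h h h / 6"
proof -
  have d: "f differentiable (at x)" "deriv1 f differentiable (at x)" "deriv2 f differentiable (at x)" for x
    using assms by (auto simp: C3_def)
  define D where "D m t = (case m of 0 \<Rightarrow> f (x + t *\<^sub>R h) | Suc 0 \<Rightarrow> deriv1 f (x + t *\<^sub>R h) h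
    | Suc (Suc 0) \<Rightarrow> deriv2 f (x + t *\<^sub>R h) h h | _ \<Rightarrow> deriv3 f (x + t *\<^sub>R h) h h h)" for m :: nat and t
  have D: "D 0 t = f (x + t *\<^sub>R h)" "D (Suc 0) t = deriv1 f (x + t *\<^sub>R h) h"
    "D 2 t = deriv2 f (x + t *\<^sub>R h) h h" "D 3 t = deriv3 f (x + t *\<^sub>R h) h h h" for t
    by (simp_all add: D_def numeral_2_eq_2 numeral_3_eq_3)
  \<comment> \<open>Evaluation at a fixed \<open>h\<close> is bounded linear, so it commutes with
    differentiation; this turns the curried derivatives into the scalar functions
    \<open>D m\<close>.\<close>
  have app: "bounded_linear (\<lambda>L. blinfun_apply L h)"
    for h :: 'a by (rule blinfun.bounded_linear_left)
  have "DERIV (D 0) t :> D 1 t" for t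
    using has_vector_derivative_along_line[OF d(1), of x h t]
    by (simp add: D[abs_def] has_real_derivative_iff_has_vector_derivative)
  moreover have "DERIV (D 1) t :> D 2 t" for t
    using bounded_linear.has_vector_derivative[OF app has_vector_derivative_along_line[OF d(2)], of x h h t]
    by (simp add: D[abs_def] has_real_derivative_iff_has_vector_derivative deriv2_def)
  moreover have "DERIV (D 2) t :> D 3 t" for t
    using bounded_linear.has_vector_derivative[OF app bounded_linear.has_vector_derivative[OF app
          has_vector_derivative_along_line[OF d(3)]], of x h h h t]
    by (simp add: D[abs_def] has_real_derivative_iff_has_vector_derivative deriv3_def)
  ultimately have "\<forall>m t. m < 3 \<and> 0 \<le> t \<and> t \<le> 1 \<longrightarrow> DERIV (D m) t :> D (Suc m) t"
    by (auto simp: less_Suc_eq numeral_3_eq_3 numeral_2_eq_2)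
  then obtain t where "D 0 1 = (\<Sum>m<3. D m 0 / fact m * 1 ^ m) + D 3 t / fact 3 * 1 ^ 3"
    using Maclaurin[of 1 3 D "D 0"] by auto
  also have "\<dots> = D 0 0 + D 1 0 + D 2 0 / 2 + D 3 t / 6"
    by (simp add: numeral_3_eq_3 numeral_2_eq_2 fact_numeral lessThan_Suc)
  finally show ?thesis using that unfolding D One_nat_def by simp
qed

lemma deriv1_minimum:
  fixes f :: "'a::real_normed_vector \<Rightarrow> real"
  assumes "C3 f" and min: "\<And>z. f x \<le> f z"
  shows "deriv1 f x h = 0"
proof -
  have d: "f differentiable (at x)" for x using assms by (auto simp: C3_def)
  have "DERIV (\<lambda>t. f (x + t *\<^sub>R h)) 0 :> deriv1 f x h"
    using has_vector_derivative_along_line[OF d, of x h 0]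
    by (simp add: has_real_derivative_iff_has_vector_derivative)
  then show ?thesis
    by (rule DERIV_local_min[of _ _ _ 1]) (use min in auto)
qed

text \<open>Bridge between the curried second derivative of the Taylor formula and the matrix whose
  inverse is \<open>\<Sigma>\<close>.\<close>

lemma deriv2_eq_hessian:
  fixes f :: "real^'n \<Rightarrow> real"
  shows "deriv2 f x h h = h \<bullet> (hessian f x *v h)"
proof -
  have h: "h = (\<Sum>i\<in>UNIV. h $ i *\<^sub>R axis i 1)"
    by (simp add: basis_expansion flip: scalar_mult_eq_scaleR)
  have "deriv2 f x h h = deriv2 f x (\<Sum>i\<in>UNIV. h $ i *\<^sub>R axis i 1) (\<Sum>j\<in>UNIV. h $ j *\<^sub>R axis j 1)"
    by (simp only: h[symmetric])
  also have "\<dots> = h \<bullet> (hessian f x *v h)"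
    by (simp add: blinfun.sum_right blinfun.sum_left blinfun.scaleR_right blinfun.scaleR_left
        inner_vec_def hessian_def matrix_vector_mult_def sum_distrib_left sum_distrib_right mult_ac)
      (subst sum.swap, simp add: mult_ac)
  finally show ?thesis .
qed

text \<open>Trilinearity: rescale \<open>h\<close> to weighted length 1, where the value is a member
  of the set whose supremum is \<open>deriv3_norm\<close>.\<close>

lemma norm_deriv3_le:
  fixes f :: "real^'n \<Rightarrow> real"
  assumes T: "pos_def (matrix_sqrt \<Sigma>)"
  shows "\<bar>deriv3 f x h h h\<bar> \<le> deriv3_norm \<Sigma> f x * weighted_norm \<Sigma> h ^ 3"
proof -
  let ?T = "matrix_sqrt \<Sigma>" and ?w = "weighted_norm \<Sigma>"
  let ?S = "{\<bar>deriv3 f x h1 h2 h3\<bar> | h1 h2 h3. ?w h1 \<le> 1 \<and> ?w h2 \<le> 1 \<and> ?w h3 \<le> 1}"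
  have TT: "?T *v (matrix_inv ?T *v v) = v" for v
    by (simp add: matrix_vector_mul_assoc pos_def_matrix_inv_mult[OF T])
  define M where "M = onorm ((*v) ?T)"
  have bl: "bounded_linear ((*v) ?T)" by (simp add: matrix_vector_mul_bounded_linear)
  have M: "M \<ge> 0" unfolding M_def using bl by (rule onorm_pos_le)
  have le_M: "norm v \<le> M" if "?w v \<le> 1" for v
  proof -
    have "norm v \<le> M * ?w v"
      using onorm[OF bl, of "matrix_inv ?T *v v"] by (simp add: TT M_def weighted_norm_def)
    also have "\<dots> \<le> M" using that M by (simp add: mult_left_le)
    finally show ?thesis .
  qed
  \<comment> \<open>A real \<open>Sup\<close> dominates the members only of a set that is bounded
    above. Boundedness holds because the weighted unit ball lies in the Euclidean ball of radius
    \<open>M\<close>, the operator norm of the root.\<close>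
  have bdd: "bdd_above ?S"
  proof (rule bdd_aboveI)
    fix s assume "s \<in> ?S"
    then obtain h1 h2 h3 where s: "s = \<bar>deriv3 f x h1 h2 h3\<bar>"
      and w: "?w h1 \<le> 1" "?w h2 \<le> 1" "?w h3 \<le> 1" by auto
    have "s \<le> norm (deriv3 f x h1 h2) * norm h3"
      unfolding s using norm_blinfun[of "deriv3 f x h1 h2" h3] by simp
    also have "\<dots> \<le> (norm (deriv3 f x h1) * norm h2) * norm h3"
      by (intro mult_right_mono norm_blinfun) auto
    also have "\<dots> \<le> (norm (deriv3 f x) * norm h1 * norm h2) * norm h3"
      by (intro mult_right_mono norm_blinfun) auto
    also have "\<dots> \<le> (norm (deriv3 f x) * M * M) * M"
      using w M by (intro mult_mono le_M) auto
    finally show "s \<le> norm (deriv3 f x) * M * M * M" .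
  qed
  show ?thesis
  proof (cases "?w h = 0")
    case True
    then have "h = 0" using TT[of h] by (simp add: weighted_norm_def)
    then have "\<bar>deriv3 f x h h h\<bar> = 0" by simp
    then show ?thesis by (simp add: True)
  next
    case False
    then have w: "?w h > 0" by (simp add: weighted_norm_def)
    define k where "k = (1 / ?w h) *\<^sub>R h"
    have "?w k = 1"
      using w by (simp add: k_def weighted_norm_def matrix_vector_mult_scaleR)
    then have "\<bar>deriv3 f x k k k\<bar> \<in> ?S" by force
    then have "\<bar>deriv3 f x k k k\<bar> \<le> deriv3_norm \<Sigma> f x"
      unfolding deriv3_norm_def using bdd by (rule cSup_upper)
    moreover have "deriv3 f x k k k = deriv3 f x h h h / ?w h ^ 3"
      by (simp add: k_def blinfun.scaleR_right blinfun.scaleR_left power3_eq_cube)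
    ultimately show ?thesis
      using w by (simp add: field_simps)
  qed
qed

subsection \<open>Laplace approximation\<close>

text \<open>Only the mass of \<open>q\<close> appears in the bound, and that is the one known in
  closed form. The two densities are written in the shapes delivered by \<open>posterior\<close> and
  \<open>gaussian_scaled_inverse\<close>.\<close>

lemma tv_dist_density_le:
  fixes p q :: "'a::euclidean_space \<Rightarrow> real"
  assumes [measurable]: "p \<in> borel_measurable borel" "q \<in> borel_measurable borel"
    and nonneg: "\<And>x. p x \<ge> 0" "\<And>x. q x \<ge> 0"
    and int: "integrable lborel p" "integrable lborel q"
    and pos: "integral\<^sup>L lborel p > 0" "integral\<^sup>L lborel q > 0"
    and diff: "(\<integral>\<^sup>+x. ennreal \<bar>p x - q x\<bar> \<partial>lborel) \<le> ennreal B" and "B \<ge> 0"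
  shows "tv_dist (density lborel (\<lambda>x. ennreal (1 / integral\<^sup>L lborel p * p x)))
      (density lborel (\<lambda>x. ennreal (q x / integral\<^sup>L lborel q))) \<le> B / integral\<^sup>L lborel q"
  unfolding tv_dist_def
proof (rule cSUP_least)
  let ?Zp = "integral\<^sup>L lborel p" and ?Zq = "integral\<^sup>L lborel q"
  fix A :: "'a set" assume A[measurable]: "A \<in> sets borel"
  define I where "I f S = (\<integral>x. indicator S x * f x \<partial>lborel)" for f :: "'a \<Rightarrow> real" and S :: "'a set"
  have ind: "integrable lborel (\<lambda>x. indicator S x * f x)"
    if "integrable lborel f" "S \<in> sets borel" for f :: "'a \<Rightarrow> real" and S :: "'a set"
    using integrable_mult_indicator[of S lborel f] that by simp
  have meas: "measure (density lborel (\<lambda>x. ennreal (f x / Z))) A = I f A / Z"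
    if "integrable lborel f" "\<And>x. f x \<ge> 0" "Z > 0" for f :: "'a \<Rightarrow> real" and Z
  proof -
    have [measurable]: "f \<in> borel_measurable borel" using that(1) by (auto dest: borel_measurable_integrable)
    have "emeasure (density lborel (\<lambda>x. ennreal (f x / Z))) A = (\<integral>\<^sup>+x. ennreal (indicator A x * f x / Z) \<partial>lborel)"
      by (subst emeasure_density) (auto intro!: nn_integral_cong split: split_indicator)
    also have "\<dots> = ennreal (\<integral>x. indicator A x * f x / Z \<partial>lborel)"
      using that by (intro nn_integral_eq_integral integrable_divide ind) auto
    finally show ?thesis
      using that by (simp add: measure_def I_def integral_nonneg_AE)
  qed
  have split: "integral\<^sup>L lborel f = I f A + I f (- A)" if "integrable lborel f" for f
  proof -
    have "I f A + I f (- A) = (\<integral>x. indicator A x * f x + indicator (- A) x * f x \<partial>lborel)"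
      unfolding I_def using that by (intro Bochner_Integration.integral_add[symmetric] ind) auto
    also have "\<dots> = integral\<^sup>L lborel f"
      by (intro Bochner_Integration.integral_cong) (auto split: split_indicator)
    finally show ?thesis ..
  qed
  have Inn: "I f S \<ge> 0" if "\<And>x. f x \<ge> 0" for f S
    unfolding I_def using that by (intro integral_nonneg_AE) auto
  have intd: "integrable lborel (\<lambda>x. \<bar>p x - q x\<bar>)"
    using int by auto
  have abs_le: "\<bar>I p S - I q S\<bar> \<le> I (\<lambda>x. \<bar>p x - q x\<bar>) S" if [measurable]: "S \<in> sets borel" for S
  proof -
    have "I p S - I q S = (\<integral>x. indicator S x * p x - indicator S x * q x \<partial>lborel)"
      unfolding I_def using that int by (intro Bochner_Integration.integral_diff[symmetric] ind) auto
    also have "\<bar>\<dots>\<bar> \<le> (\<integral>x. \<bar>indicator S x * p x - indicator S x * q x\<bar> \<partial>lborel)"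
      by (rule integral_abs_bound)
    also have "\<dots> = I (\<lambda>x. \<bar>p x - q x\<bar>) S"
      unfolding I_def by (intro Bochner_Integration.integral_cong) (auto split: split_indicator)
    finally show ?thesis .
  qed
  have "ennreal (\<integral>x. \<bar>p x - q x\<bar> \<partial>lborel) \<le> ennreal B"
    using diff intd by (subst (asm) nn_integral_eq_integral) auto
  then have D: "(\<integral>x. \<bar>p x - q x\<bar> \<partial>lborel) \<le> B"
    using \<open>B \<ge> 0\<close> by (simp add: ennreal_le_iff)
  define m where "m = I p A / ?Zp"
  have m: "0 \<le> m" "m \<le> 1"
    using pos(1) split[OF int(1)] Inn[of p A] Inn[of p "- A"] nonneg(1) by (auto simp: m_def divide_simps)
  txt \<open>Weighting by \<open>m\<close> avoids the factor 2 that the triangle inequality on the normalizations would cost.\<close>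
  have "m * ?Zp = I p A" using pos(1) by (simp add: m_def)
  \<comment> \<open>This identity uses that \<open>m\<close> times the whole mass of
    \<open>p\<close> is its mass on \<open>A\<close>. The errors on \<open>A\<close> and on its
    complement get weights \<open>1 - m\<close> and \<open>m\<close>, both at most 1, so together
    they cost one integral of \<open>\<bar>p x - q x\<bar>\<close>.\<close>
  then have "m * ?Zq - I q A = (1 - m) * (I p A - I q A) - m * (I p (- A) - I q (- A))"
    unfolding split[OF int(1)] split[OF int(2)] by (simp add: algebra_simps)
  also have "\<bar>\<dots>\<bar> \<le> (1 - m) * \<bar>I p A - I q A\<bar> + m * \<bar>I p (- A) - I q (- A)\<bar>"
    using m by (intro order_trans[OF abs_triangle_ineq4]) (simp add: abs_mult)
  also have "\<dots> \<le> 1 * I (\<lambda>x. \<bar>p x - q x\<bar>) A + 1 * I (\<lambda>x. \<bar>p x - q x\<bar>) (- A)"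
    using m by (intro add_mono mult_mono abs_le) auto
  also have "\<dots> \<le> B" using D split[OF intd] by simp
  finally have "\<bar>m * ?Zq - I q A\<bar> \<le> B" .
  then have "\<bar>m * ?Zq - I q A\<bar> / ?Zq \<le> B / ?Zq"
    using pos(2) by (intro divide_right_mono) auto
  also have "\<bar>m * ?Zq - I q A\<bar> / ?Zq = \<bar>m - I q A / ?Zq\<bar>"
  proof -
    have "m - I q A / ?Zq = (m * ?Zq - I q A) / ?Zq" using pos(2) by (simp add: field_simps)
    then show ?thesis using pos(2) by (simp add: abs_divide)
  qed
  finally show "\<bar>measure (density lborel (\<lambda>x. ennreal (1 / ?Zp * p x))) A
      - measure (density lborel (\<lambda>x. ennreal (q x / ?Zq))) A\<bar> \<le> B / ?Zq"
    using meas[OF int(1) nonneg(1) pos(1)] meas[OF int(2) nonneg(2) pos(2)] by (simp add: m_def)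
qed auto

section \<open>The error integral on the ball and on the tail\<close>

lemma abs_exp_minus_1_le: "\<bar>exp x - 1\<bar> \<le> exp \<bar>x\<bar> - (1::real)"
proof (cases "x \<ge> 0")
  case False
  \<comment> \<open>For negative \<open>x\<close> the claim reads
    \<open>1 - exp x \<le> exp (- x) - 1\<close>.\<close>
  have "2 \<le> exp x + exp (- x)"
    using exp_ge_add_one_self[of x] exp_ge_add_one_self[of "- x"] by linarith
  with False show ?thesis by simp
qed simp

lemma nn_integral_radial_cball:
  fixes g :: "real \<Rightarrow> real"
  assumes r0: "r0 \<ge> 0" and cont: "continuous_on UNIV g" and nonneg: "\<And>r. r \<ge> 0 \<Longrightarrow> g r \<ge> 0"
  shows "(\<integral>\<^sup>+(x::'a::euclidean_space). ennreal (g (norm x)) * indicator {..r0} (norm x) \<partial>lborel)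
    = ennreal (DIM('a) * unit_ball_vol DIM('a) * integral {0..r0} (\<lambda>r. g r * r ^ (DIM('a) - 1)))"
proof -
  let ?d = "DIM('a)"
  have [measurable]: "g \<in> borel_measurable borel"
    using cont by (rule borel_measurable_continuous_onI)
  have "(\<integral>\<^sup>+(x::'a). ennreal (g (norm x)) * indicator {..r0} (norm x) \<partial>lborel)
    = ?d * unit_ball_vol ?d * (\<integral>\<^sup>+r. ennreal (r ^ (?d - 1)) * indicator {0..} r * (ennreal (g r) * indicator {..r0} r) \<partial>lborel)"
    by (rule nn_integral_norm_lborel) simp
  also have "(\<integral>\<^sup>+r. ennreal (r ^ (?d - 1)) * indicator {0..} r * (ennreal (g r) * indicator {..r0} r) \<partial>lborel)
    = (\<integral>\<^sup>+r. ennreal (g r * r ^ (?d - 1)) * indicator {0..r0} r \<partial>lborel)"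
    using nonneg by (intro nn_integral_cong) (auto simp: ennreal_mult mult_ac split: split_indicator)
  also have "\<dots> = ennreal (integral {0..r0} (\<lambda>r. g r * r ^ (?d - 1)))"
  proof (rule nn_integral_has_integral_lebesgue')
    show "((\<lambda>r. g r * r ^ (?d - 1)) has_integral integral {0..r0} (\<lambda>r. g r * r ^ (?d - 1))) {0..r0}"
      using cont by (intro integrable_integral integrable_continuous_real continuous_intros)
        (auto intro: continuous_on_subset)
  qed (use nonneg in auto)
  also have "ennreal (?d * unit_ball_vol ?d) * ennreal (integral {0..r0} (\<lambda>r. g r * r ^ (?d - 1)))
    = ennreal (?d * unit_ball_vol ?d * integral {0..r0} (\<lambda>r. g r * r ^ (?d - 1)))"
    by (rule ennreal_mult'[symmetric]) simp
  finally show ?thesis .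
qed

lemma borel_measurable_matrix_vector_mult [measurable]:
  fixes A :: "real^'n^'m"
  assumes "f \<in> borel_measurable M"
  shows "(\<lambda>x. A *v f x) \<in> borel_measurable M"
  using assms by (rule borel_measurable_continuous_on[rotated]) (intro continuous_intros)

lemma error_f_nonneg:
  assumes "\<epsilon> > 0" "K > 0" "r \<ge> 0"
  shows "error_f \<epsilon> K r \<ge> 0"
  using assms by (simp add: error_f_def)

lemma continuous_on_error_f: "\<epsilon> > 0 \<Longrightarrow> continuous_on S (error_f \<epsilon> K)"
  unfolding error_f_def by (intro continuous_intros) auto

lemma integral_error_f_nonneg:
  assumes "\<epsilon> > 0" "K > 0"
  shows "integral {0..r0} (\<lambda>r. error_f \<epsilon> K r * r ^ n) \<ge> 0"
  using assms
  by (intro integral_nonneg integrable_continuous_real continuous_intros continuous_on_error_f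
      mult_nonneg_nonneg error_f_nonneg) auto

lemma E1_nonneg:
  assumes "\<epsilon> > 0" "K > 0" "d > 0"
  shows "E1 d \<epsilon> K r0 \<ge> 0"
  using assms integral_error_f_nonneg[OF assms(1,2)] Gamma_real_nonneg[of "real d / 2"]
  by (simp add: E1_def const_c_def)

lemma E2_nonneg:
  assumes "\<epsilon> > 0" "\<delta> > 0" "d > 0"
  shows "E2 d \<epsilon> \<delta> r0 \<ge> 0"
  using assms Xi_le_1[of d "\<delta> * r0\<^sup>2 / \<epsilon>"] by (simp add: E2_def)

text \<open>The prefactor on the right is exactly the mass of the Gaussian \<open>q\<close>, so that
  dividing by it leaves \<open>E1 + E2\<close>. Of \<open>I\<close> only the normalized Taylor
  estimate and the quadratic lower bound enter, both already in the coordinate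
  \<open>u\<close>.\<close>

lemma nn_integral_laplace_error:
  fixes I :: "real^'n \<Rightarrow> real"
  assumes eps: "\<epsilon> > 0" and delta: "0 < \<delta>" "\<delta> \<le> 1" and K: "K > 0" and r0: "r0 \<ge> 0"
    and T: "pos_def T" and [measurable]: "I \<in> borel_measurable borel"
    and taylor: "\<And>u. \<bar>I (m + T *v u) - (norm u)\<^sup>2 / 2\<bar> \<le> (1 + \<epsilon>) * K / 6 * norm u ^ 3"
    and lower: "\<And>u. I (m + T *v u) \<ge> \<delta> / 2 * (norm u)\<^sup>2"
  shows "(\<integral>\<^sup>+x. ennreal \<bar>exp (- (1 / \<epsilon>) * I x) - exp (- (norm (matrix_inv T *v (x - m)))\<^sup>2 / (2 * \<epsilon>))\<bar> \<partial>lborel)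
    \<le> ennreal (det T * (2 * pi * \<epsilon>) powr (CARD('n) / 2) * (E1 CARD('n) \<epsilon> K r0 + E2 CARD('n) \<epsilon> \<delta> r0))"
proof -
  let ?d = "CARD('n)"
  let ?p = "\<lambda>u. exp (- (1 / \<epsilon>) * I (m + T *v u))" and ?q = "\<lambda>u::real^'n. exp (- (norm u)\<^sup>2 / (2 * \<epsilon>))"
  let ?a = "\<delta> / (2 * \<epsilon>)"
  have Tinv: "matrix_inv T *v (T *v u) = u" for u
    by (simp add: matrix_vector_mul_assoc pos_def_matrix_inv_mult[OF T])
  have near: "\<bar>?p u - ?q u\<bar> \<le> error_f \<epsilon> K (norm u)" for u
  proof -
    \<comment> \<open>\<open>\<rho>\<close> is the difference of the exponents, that is, the Taylor
      remainder divided by \<open>\<epsilon>\<close>. Its sign is unknown, hence the estimate by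
      \<open>exp \<bar>\<rho>\<bar> - 1\<close>.\<close>
    define \<rho> where "\<rho> = ((norm u)\<^sup>2 / 2 - I (m + T *v u)) / \<epsilon>"
    have "\<bar>\<rho>\<bar> \<le> (1 + \<epsilon>) * K / 6 * norm u ^ 3 / \<epsilon>"
      using eps divide_right_mono[OF taylor[of u], of \<epsilon>]
      by (simp add: \<rho>_def abs_divide abs_minus_commute)
    then have \<rho>: "\<bar>\<rho>\<bar> \<le> (1 + \<epsilon>) * K / (6 * \<epsilon>) * norm u ^ 3" by simp
    have "?p u = ?q u * exp \<rho>"
      using eps by (simp add: \<rho>_def exp_add[symmetric] field_simps)
    then have "?p u - ?q u = (exp \<rho> - 1) * ?q u"
      by (simp add: algebra_simps)
    then have "\<bar>?p u - ?q u\<bar> = \<bar>exp \<rho> - 1\<bar> * ?q u"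
      by (simp only: abs_mult abs_exp_cancel)
    also have "\<dots> \<le> (exp \<bar>\<rho>\<bar> - 1) * ?q u"
      by (intro mult_right_mono abs_exp_minus_1_le) simp
    also have "\<dots> \<le> (exp ((1 + \<epsilon>) * K / (6 * \<epsilon>) * norm u ^ 3) - 1) * ?q u"
      using \<rho> by (intro mult_right_mono) auto
    also have "\<dots> = error_f \<epsilon> K (norm u)" by (simp add: error_f_def)
    finally show ?thesis .
  qed
  \<comment> \<open>Two nonnegative numbers differ by no more than the larger one, so no factor 2
    arises.\<close>
  have far: "\<bar>?p u - ?q u\<bar> \<le> exp (- ?a * (norm u)\<^sup>2)" for u
  proof -
    have "?p u \<le> exp (- ?a * (norm u)\<^sup>2)"
      using lower[of u] eps by (simp add: field_simps)
    moreover have "?q u \<le> exp (- ?a * (norm u)\<^sup>2)"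
      using delta eps mult_right_mono[OF delta(2), of "(norm u)\<^sup>2"] by (simp add: field_simps)
    moreover have "?p u > 0" "?q u > 0" by simp_all
    ultimately show ?thesis by linarith
  qed
  have [measurable]: "error_f \<epsilon> K \<in> borel_measurable borel"
    using continuous_on_error_f[OF eps] by (rule borel_measurable_continuous_onI)
  let ?V = "?d * unit_ball_vol ?d * integral {0..r0} (\<lambda>r. error_f \<epsilon> K r * r ^ (?d - 1))"
  let ?W = "(pi / ?a) powr (?d / 2) * (1 - Xi ?d (2 * ?a * r0\<^sup>2))"
  have "(\<integral>\<^sup>+u. ennreal \<bar>?p u - ?q u\<bar> \<partial>lborel)
    \<le> (\<integral>\<^sup>+(u::real^'n). ennreal (error_f \<epsilon> K (norm u)) * indicator {..r0} (norm u)
        + ennreal (exp (- ?a * (norm u)\<^sup>2)) * indicator {r0<..} (norm u) \<partial>lborel)"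
    by (intro nn_integral_mono) (use near far in \<open>auto split: split_indicator simp: ennreal_leI\<close>)
  also have "\<dots> = ennreal ?V + ennreal ?W"
    using nn_integral_radial_cball[OF r0 continuous_on_error_f[OF eps] error_f_nonneg[OF eps K], where 'a = "real^'n"]
      nn_integral_gaussian_tail[OF _ r0, of ?a, where 'a = "real^'n"] delta eps
    by (subst nn_integral_add) auto
  also have "\<dots> = ennreal (?V + ?W)"
  proof (rule ennreal_plus[symmetric])
    show "?V \<ge> 0"
      using integral_error_f_nonneg[OF eps K] by simp
    show "?W \<ge> 0"
      using Xi_le_1[of ?d "2 * ?a * r0\<^sup>2"] delta eps by simp
  qed
  also have "?V + ?W = (2 * pi * \<epsilon>) powr (?d / 2) * (E1 ?d \<epsilon> K r0 + E2 ?d \<epsilon> \<delta> r0)"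
  proof -
    \<comment> \<open>The powers of 2 and of \<open>\<epsilon>\<close> in \<open>const_c\<close> and
      \<open>E1\<close> cancel against those in the Gaussian mass, leaving the sphere area
      \<open>2 * pi powr (d / 2) / Gamma (d / 2)\<close>.\<close>
    have "2 powr (1 - real ?d / 2) * 2 powr (real ?d / 2) = (2::real)"
      by (simp flip: powr_add)
    moreover have "\<epsilon> powr (- real ?d / 2) * \<epsilon> powr (real ?d / 2) = 1"
      using eps by (simp flip: powr_add)
    ultimately have "(2 * pi * \<epsilon>) powr (?d / 2) * (const_c ?d * \<epsilon> powr (- real ?d / 2))
        = 2 * pi powr (?d / 2) / Gamma (?d / 2)"
      using eps by (simp add: const_c_def powr_mult field_simps)
    then have "?V = (2 * pi * \<epsilon>) powr (?d / 2) * E1 ?d \<epsilon> K r0"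
      by (simp add: E1_def sphere_area mult.assoc[symmetric])
    \<comment> \<open>The tail Gaussian has rate \<open>?a = \<delta> / (2 * \<epsilon>)\<close>;
      comparing its mass with that of \<open>q\<close> produces
      \<open>\<delta> powr (- d / 2)\<close>, and \<open>2 * ?a * r0\<^sup>2\<close> is the argument
      of \<open>Xi\<close> in \<open>E2\<close>.\<close>
    moreover have "pi / ?a = 2 * pi * \<epsilon> * (1 / \<delta>)" by simp
    then have "(pi / ?a) powr (?d / 2) = (2 * pi * \<epsilon>) powr (?d / 2) * \<delta> powr (- real ?d / 2)"
      using eps delta by (simp only: powr_mult) (simp add: powr_minus_divide powr_divide)
    then have "?W = (2 * pi * \<epsilon>) powr (?d / 2) * E2 ?d \<epsilon> \<delta> r0"
      by (simp add: E2_def)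
    ultimately show ?thesis by (simp add: distrib_left)
  qed
  finally have bound: "(\<integral>\<^sup>+u. ennreal \<bar>?p u - ?q u\<bar> \<partial>lborel)
      \<le> ennreal ((2 * pi * \<epsilon>) powr (?d / 2) * (E1 ?d \<epsilon> K r0 + E2 ?d \<epsilon> \<delta> r0))" .
  have "(\<integral>\<^sup>+x. ennreal \<bar>exp (- (1 / \<epsilon>) * I x) - exp (- (norm (matrix_inv T *v (x - m)))\<^sup>2 / (2 * \<epsilon>))\<bar> \<partial>lborel)
      = ennreal (det T) * (\<integral>\<^sup>+u. ennreal \<bar>?p u - ?q u\<bar> \<partial>lborel)"
    by (subst nn_integral_lborel_affine_pos_def[OF T, of _ m]) (simp_all add: Tinv)
  also have "\<dots> \<le> ennreal (det T) * ennreal ((2 * pi * \<epsilon>) powr (?d / 2) * (E1 ?d \<epsilon> K r0 + E2 ?d \<epsilon> \<delta> r0))"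
    by (intro mult_left_mono bound) simp
  also have "\<dots> = ennreal (det T * (2 * pi * \<epsilon>) powr (?d / 2) * (E1 ?d \<epsilon> K r0 + E2 ?d \<epsilon> \<delta> r0))"
    using det_pos_def[OF T] by (simp add: ennreal_mult' mult.assoc)
  finally show ?thesis .
qed

section \<open>Passage to coordinates in which the Hessian is the identity\<close>

lemma weighted_norm_affine:
  assumes "pos_def (matrix_sqrt \<Sigma>)"
  shows "weighted_norm \<Sigma> (matrix_sqrt \<Sigma> *v u) = norm u"
  by (simp add: weighted_norm_def matrix_vector_mul_assoc pos_def_matrix_inv_mult[OF assms])

text \<open>At the minimizer the linear term vanishes, and the square root of the inverse Hessian is
  the substitution that turns the quadratic term into half the squared Euclidean norm; only the
  cubic remainder is left.\<close>

lemma C3_taylor_weighted_norm: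
  fixes f :: "real^'n \<Rightarrow> real"
  assumes f: "C3 f" and H: "pos_def (hessian f m)" and \<Sigma>: "\<Sigma> = matrix_inv (hessian f m)"
    and min: "\<And>x. f m \<le> f x" and M: "\<And>x h. \<bar>deriv3 f x h h h\<bar> \<le> M * weighted_norm \<Sigma> h ^ 3"
  shows "\<bar>f (m + matrix_sqrt \<Sigma> *v u) - f m - (norm u)\<^sup>2 / 2\<bar> \<le> M / 6 * norm u ^ 3"
proof -
  let ?T = "matrix_sqrt \<Sigma>" and ?h = "matrix_sqrt \<Sigma> *v u"
  have pd: "pos_def \<Sigma>" unfolding \<Sigma> by (rule pos_def_matrix_inv[OF H])
  note T = pos_def_matrix_sqrt[OF pd]
  obtain t where t: "f (m + ?h) = f m + deriv1 f m ?h + deriv2 f m ?h ?h / 2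
      + deriv3 f (m + t *\<^sub>R ?h) ?h ?h ?h / 6"
    using C3_taylor[OF f] .
  have "deriv2 f m ?h ?h = ?h \<bullet> (hessian f m *v ?h)" by (rule deriv2_eq_hessian)
  also have "\<dots> = (norm u)\<^sup>2"
  proof -
    have sym: "transpose ?T = ?T" using T by (simp add: pos_def_def)
    have "?T ** (hessian f m ** ?T) = mat 1"
    proof -
      \<comment> \<open>\<open>?T ** hessian f m\<close> is a right inverse of \<open>?T\<close>,
        hence also a left one. So the Hessian sandwiched between two copies of the root is the
        identity.\<close>
      have "?T ** (?T ** hessian f m) = mat 1"
        by (simp add: matrix_mul_assoc matrix_sqrt_mult_self[OF pd])
          (simp add: \<Sigma> pos_def_matrix_inv_mult[OF H])
      then have "(?T ** hessian f m) ** ?T = mat 1"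
        by (simp only: matrix_left_right_inverse)
      then show ?thesis by (simp only: matrix_mul_assoc)
    qed
    then have "?T *v (hessian f m *v ?h) = u"
      by (simp only: matrix_vector_mul_assoc matrix_mul_assoc) simp
    then show ?thesis
      using symmetric_inner_swap[OF sym, of u "hessian f m *v ?h"] by (simp add: dot_square_norm)
  qed
  finally have rem: "f (m + ?h) - f m - (norm u)\<^sup>2 / 2 = deriv3 f (m + t *\<^sub>R ?h) ?h ?h ?h / 6"
    using t deriv1_minimum[OF f min] by simp
  show ?thesis
    unfolding rem using M[of "m + t *\<^sub>R ?h" ?h] by (simp add: weighted_norm_affine[OF T])
qed

lemma det_scaleR:
  fixes A :: "real^'n^'n"
  shows "det (c *\<^sub>R A) = c ^ CARD('n) * det A"
  by (simp add: det_def prod.distrib sum_distrib_left mult_ac)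

text \<open>Expresses the Gaussian through the root of \<open>\<Sigma>\<close>: the quadratic form
  becomes a squared norm, and the root of \<open>det (\<epsilon> *\<^sub>R \<Sigma>)\<close> becomes
  a power of \<open>\<epsilon>\<close> times the positive number
  \<open>det (matrix_sqrt \<Sigma>)\<close>, the Jacobian of the substitution.\<close>

lemma gaussian_scaled_inverse:
  fixes H :: "real^'n^'n"
  assumes H: "pos_def H" and eps: "\<epsilon> > 0" and \<Sigma>: "\<Sigma> = matrix_inv H"
  shows "gaussian m (\<epsilon> *\<^sub>R \<Sigma>) = density lborel (\<lambda>x. ennreal
    (exp (- (norm (matrix_inv (matrix_sqrt \<Sigma>) *v (x - m)))\<^sup>2 / (2 * \<epsilon>))
      / ((2 * pi * \<epsilon>) powr (CARD('n) / 2) * det (matrix_sqrt \<Sigma>))))"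
proof -
  let ?T = "matrix_sqrt \<Sigma>" and ?d = "CARD('n)"
  have pd: "pos_def \<Sigma>" unfolding \<Sigma> by (rule pos_def_matrix_inv[OF H])
  note T = pos_def_matrix_sqrt[OF pd]
  let ?S = "matrix_inv ?T"
  have "\<Sigma> ** (?S ** ?S) = (?T ** ?T) ** (?S ** ?S)"
    by (simp only: matrix_sqrt_mult_self[OF pd])
  also have "\<dots> = ?T ** (?T ** ?S) ** ?S"
    by (simp only: matrix_mul_assoc)
  also have "\<dots> = mat 1" by (simp add: pos_def_matrix_inv_mult[OF T])
  finally have "(\<epsilon> *\<^sub>R \<Sigma>) ** ((1 / \<epsilon>) *\<^sub>R (?S ** ?S)) = mat 1"
    using eps by (simp add: matrix_scalar_ac flip: scalar_matrix_assoc)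
  then have inv: "matrix_inv (\<epsilon> *\<^sub>R \<Sigma>) = (1 / \<epsilon>) *\<^sub>R (?S ** ?S)" by (rule matrix_inv_eq)
  have sym: "transpose ?S = ?S"
    using pos_def_matrix_inv[OF T] by (simp add: pos_def_def)
  have quad: "x \<bullet> (matrix_inv (\<epsilon> *\<^sub>R \<Sigma>) *v x) = (norm (?S *v x))\<^sup>2 / \<epsilon>" for x
    using symmetric_inner_swap[OF sym, of x "?S *v x"]
    by (simp add: inv scaleR_matrix_vector_assoc[symmetric] matrix_vector_mul_assoc[symmetric] dot_square_norm)
  have "det (\<epsilon> *\<^sub>R \<Sigma>) = \<epsilon> ^ ?d * det (?T ** ?T)"
    by (simp only: det_scaleR matrix_sqrt_mult_self[OF pd])
  then have "sqrt ((2 * pi) ^ ?d * det (\<epsilon> *\<^sub>R \<Sigma>)) = sqrt ((2 * pi * \<epsilon>) ^ ?d * (det ?T)\<^sup>2)"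
    by (simp add: det_mul power_mult_distrib power2_eq_square mult_ac)
  also have "\<dots> = sqrt ((2 * pi * \<epsilon>) ^ ?d) * det ?T"
    using det_pos_def[OF T] by (simp add: real_sqrt_mult)
  also have "sqrt ((2 * pi * \<epsilon>) ^ ?d) = (2 * pi * \<epsilon>) powr (?d / 2)"
    using eps by (simp add: powr_powr flip: powr_half_sqrt powr_realpow)
  finally show ?thesis
    unfolding gaussian_def quad by (simp add: mult.commute)
qed

theorem theorem3p4:
  fixes G :: "real ^ 'n \<Rightarrow> real ^ 'n"
    and y :: "real ^ 'n"
    and \<epsilon> K \<delta> :: real
    and \<Phi> R I :: "real ^ 'n \<Rightarrow> real"
    and xhat :: "real ^ 'n"
    and \<Sigma> :: "real ^ 'n ^ 'n"
  assumes eps_pos: "0 < \<epsilon>"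
    and prior: "prob_space (prior R)"
    and Phi: "\<Phi> = misfit G y"
    and xhat: "xhat = map_estimate \<Phi> R \<epsilon>"
    and I: "I = (\<lambda>x. \<Phi> x + \<epsilon> * R x - \<Phi> xhat - \<epsilon> * R xhat)"
    and Sigma: "\<Sigma> = matrix_inv (hessian I xhat)"
    and smooth: "C3 \<Phi>" "C3 R"
    and minimizer: "unique_minimizer I xhat"
    and hessian_pos: "pos_def (hessian I xhat)"
    and K_pos: "0 < K"
    and third_derivs: "\<And>x. max (deriv3_norm \<Sigma> \<Phi> x) (deriv3_norm \<Sigma> R x) \<le> K"
    and delta: "0 < \<delta>" "\<delta> \<le> 1"
    and lower_bound: "\<And>x. I x \<ge> \<delta> / 2 * (weighted_norm \<Sigma> (x - xhat))\<^sup>2"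
  shows "\<forall>r0\<ge>0. tv_dist (posterior \<epsilon> I) (gaussian xhat (\<epsilon> *\<^sub>R \<Sigma>))
           \<le> E1 (CARD('n)) \<epsilon> K r0 + E2 (CARD('n)) \<epsilon> \<delta> r0"
proof (intro allI impI)
  fix r0 :: real assume r0: "r0 \<ge> 0"
  let ?T = "matrix_sqrt \<Sigma>" and ?d = "CARD('n)"
  let ?E = "E1 ?d \<epsilon> K r0 + E2 ?d \<epsilon> \<delta> r0"
  have pd: "pos_def \<Sigma>" unfolding Sigma by (rule pos_def_matrix_inv[OF hessian_pos])
  note T = pos_def_matrix_sqrt[OF pd]
  have I_eq: "I = (\<lambda>x. \<Phi> x + \<epsilon> *\<^sub>R R x + (- \<Phi> xhat - \<epsilon> * R xhat))"
    by (simp add: I fun_eq_iff)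
  have I0: "I xhat = 0" by (simp add: I)
  have C3I: "C3 I" unfolding I_eq by (rule C3_linear_combination(1)[OF smooth])
  have D3I: "deriv3 I = (\<lambda>x. deriv3 \<Phi> x + \<epsilon> *\<^sub>R deriv3 R x)"
    unfolding I_eq by (rule C3_linear_combination(2)[OF smooth])
  have "continuous_on UNIV I"
    using C3I by (auto simp: C3_def intro!: continuous_at_imp_continuous_on differentiable_imp_continuous_within)
  then have [measurable]: "I \<in> borel_measurable borel"
    by (rule borel_measurable_continuous_onI)
  have lower: "I (xhat + ?T *v u) \<ge> \<delta> / 2 * (norm u)\<^sup>2" for u
    using lower_bound[of "xhat + ?T *v u"] by (simp add: weighted_norm_affine[OF T])
  have "0 \<le> \<delta> / 2 * (weighted_norm \<Sigma> (x - xhat))\<^sup>2" for x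
    using delta by simp
  then have min: "I xhat \<le> I x" for x
    unfolding I0 using lower_bound[of x] order_trans by blast
  \<comment> \<open>\<open>\<Phi>\<close> contributes \<open>K\<close> and
    \<open>\<epsilon> * R\<close> contributes \<open>\<epsilon> * K\<close>.\<close>
  have third: "\<bar>deriv3 I x h h h\<bar> \<le> (1 + \<epsilon>) * K * weighted_norm \<Sigma> h ^ 3" for x h
  proof -
    have w: "weighted_norm \<Sigma> h ^ 3 \<ge> 0" by (simp add: weighted_norm_def)
    have "\<bar>deriv3 \<Phi> x h h h\<bar> \<le> K * weighted_norm \<Sigma> h ^ 3"
      using third_derivs[of x] w by (intro order_trans[OF norm_deriv3_le[OF T]] mult_right_mono) auto
    moreover have "\<bar>deriv3 R x h h h\<bar> \<le> K * weighted_norm \<Sigma> h ^ 3"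
      using third_derivs[of x] w by (intro order_trans[OF norm_deriv3_le[OF T]] mult_right_mono) auto
    then have "\<epsilon> * \<bar>deriv3 R x h h h\<bar> \<le> \<epsilon> * (K * weighted_norm \<Sigma> h ^ 3)"
      using eps_pos by simp
    moreover have "\<bar>deriv3 I x h h h\<bar> \<le> \<bar>deriv3 \<Phi> x h h h\<bar> + \<epsilon> * \<bar>deriv3 R x h h h\<bar>"
      using eps_pos abs_triangle_ineq[of "deriv3 \<Phi> x h h h" "\<epsilon> * deriv3 R x h h h"]
      by (simp add: D3I blinfun.add_left blinfun.scaleR_left abs_mult)
    ultimately show ?thesis by (simp add: algebra_simps)
  qed
  have taylor: "\<bar>I (xhat + ?T *v u) - (norm u)\<^sup>2 / 2\<bar> \<le> (1 + \<epsilon>) * K / 6 * norm u ^ 3" for u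
    using C3_taylor_weighted_norm[OF C3I hessian_pos Sigma min third, of u] by (simp add: I0)
  define p where "p x = exp (- (1 / \<epsilon>) * I x)" for x
  define q where "q x = exp (- (norm (matrix_inv ?T *v (x - xhat)))\<^sup>2 / (2 * \<epsilon>))" for x
  define Z where "Z = (2 * pi * \<epsilon>) powr (?d / 2) * det ?T"
  have Z: "Z > 0" using eps_pos det_pos_def[OF T] by (simp add: Z_def)
  have Tinv: "matrix_inv ?T *v (?T *v u) = u" for u
    by (simp add: matrix_vector_mul_assoc pos_def_matrix_inv_mult[OF T])
  have nonneg: "p x \<ge> 0" "q x \<ge> 0" for x by (simp_all add: p_def q_def)
  have [measurable]: "p \<in> borel_measurable borel" by (simp add: p_def[abs_def])
  have [measurable]: "q \<in> borel_measurable borel" by (simp add: q_def[abs_def])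
  have nn_q: "(\<integral>\<^sup>+x. ennreal (q x) \<partial>lborel) = ennreal Z"
  proof -
    have "(\<integral>\<^sup>+x. ennreal (q x) \<partial>lborel) = ennreal (det ?T) * (\<integral>\<^sup>+u. ennreal (q (xhat + ?T *v u)) \<partial>lborel)"
      by (rule nn_integral_lborel_affine_pos_def[OF T]) simp
    also have "(\<integral>\<^sup>+u. ennreal (q (xhat + ?T *v u)) \<partial>lborel)
        = (\<integral>\<^sup>+(u::real^'n). ennreal (exp (- (1 / (2 * \<epsilon>)) * (norm u)\<^sup>2)) \<partial>lborel)"
      by (simp add: q_def Tinv)
    also have "\<dots> = ennreal ((2 * pi * \<epsilon>) powr (?d / 2))"
      using eps_pos by (subst nn_integral_gaussian) (auto simp: mult_ac)
    finally show ?thesis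
      using det_pos_def[OF T] by (simp add: Z_def mult.commute flip: ennreal_mult')
  qed
  then have int_q: "integrable lborel q"
    by (intro integrableI_nonneg) (auto simp: q_def)
  have int_qZ: "integral\<^sup>L lborel q = Z"
    using nn_q Z by (subst integral_eq_nn_integral) (auto simp: q_def)
  \<comment> \<open>The quadratic lower bound on \<open>I\<close> dominates \<open>p\<close> by a
    Gaussian. Integrability matters for the meaning of \<open>posterior\<close>: the integral of a
    non-integrable function is 0 by convention, and so would be the normalization \<open>Z\<close>
    there.\<close>
  have int_p: "integrable lborel p"
  proof (rule integrableI_nonneg)
    have "(\<integral>\<^sup>+x. ennreal (p x) \<partial>lborel) = ennreal (det ?T) * (\<integral>\<^sup>+u. ennreal (p (xhat + ?T *v u)) \<partial>lborel)"
      by (rule nn_integral_lborel_affine_pos_def[OF T]) simp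
    also have "\<dots> \<le> ennreal (det ?T) * (\<integral>\<^sup>+(u::real^'n). ennreal (exp (- (\<delta> / (2 * \<epsilon>)) * (norm u)\<^sup>2)) \<partial>lborel)"
    proof (intro mult_left_mono nn_integral_mono ennreal_leI)
      show "p (xhat + ?T *v u) \<le> exp (- (\<delta> / (2 * \<epsilon>)) * (norm u)\<^sup>2)" for u
        using lower[of u] eps_pos by (simp add: p_def field_simps)
    qed simp
    also have "\<dots> < \<infinity>"
      using eps_pos delta by (subst nn_integral_gaussian) (auto simp: ennreal_mult_less_top)
    finally show "(\<integral>\<^sup>+x. ennreal (p x) \<partial>lborel) < \<infinity>" .
  qed (auto simp: p_def)
  \<comment> \<open>\<open>p\<close> is positive everywhere, so its integral could vanish only if
    \<open>lborel\<close> were the null measure.\<close>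
  have pos_p: "integral\<^sup>L lborel p > 0"
  proof -
    have "integral\<^sup>L lborel p \<noteq> 0"
      using int_p by (subst integral_nonneg_eq_0_iff_AE) (auto simp: p_def eventually_False ae_filter_eq_bot_iff)
    moreover have "integral\<^sup>L lborel p \<ge> 0" by (simp add: p_def integral_nonneg_AE)
    ultimately show ?thesis by simp
  qed
  have err: "(\<integral>\<^sup>+x. ennreal \<bar>p x - q x\<bar> \<partial>lborel) \<le> ennreal (Z * ?E)"
    using nn_integral_laplace_error[OF eps_pos delta K_pos r0 T _ taylor lower]
    by (simp add: p_def q_def Z_def mult_ac)
  have E: "Z * ?E \<ge> 0"
    using Z E1_nonneg[OF eps_pos K_pos, of ?d r0] E2_nonneg[OF eps_pos delta(1), of ?d r0] by simp
  have "tv_dist (density lborel (\<lambda>x. ennreal (1 / integral\<^sup>L lborel p * p x)))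
      (density lborel (\<lambda>x. ennreal (q x / integral\<^sup>L lborel q))) \<le> Z * ?E / integral\<^sup>L lborel q"
    using int_p int_q pos_p err E Z nonneg int_qZ by (intro tv_dist_density_le) auto
  also have "\<dots> = ?E" using Z by (simp add: int_qZ)
  finally show "tv_dist (posterior \<epsilon> I) (gaussian xhat (\<epsilon> *\<^sub>R \<Sigma>)) \<le> ?E"
    unfolding gaussian_scaled_inverse[OF hessian_pos eps_pos Sigma] posterior_def Let_def
      int_qZ by (simp add: p_def[abs_def] q_def[abs_def] Z_def)
qed

end
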